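(* Let $U\neq\emptyset$ be a connected open set in $\mathbb{R}^d$, $d\ge2$, and let $A\subset U$ be relatively closed in $U$. For $n\in\mathbb{N}$ let $0\le\gamma_n<1$ and let $V_n$ be bounded open sets in $U$ such that $\overline V_n\subset V_{n+1}$ for all $n$ and $V_n\uparrow U$ (i.e. $\bigcup_n V_n=U$). Suppose that for all $n\in\mathbb{N}$ and all $z\in\partial V_n\setminus A$ there exists a closed set $E$ in $A\cap V_{n+1}$ such that $$H_{V_{n+1}\setminus E}1_E(z)\ge\gamma_n .$$ Then, for all $n,m\in\mathbb{N}$ with $n<m$, $$H_{U\setminus A}1_A\ge 1-\prod_{n\le j<m}(1-\gamma_j)\quad\text{on }\overline V_n.$$ In particular, $A$ is unavoidable if the series $\sum\gamma_n$ is divergent.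
   Context: For an open set $W$ in $\mathbb{R}^d$ and $x\in W$, $\mu_x^W$ denotes the harmonic measure at $x$ with respect to $W$ (the distribution of the point in $\partial W\subset\mathbb{R}^d$ at which Brownian motion started at $x$ exits $W$; its total mass may be less than $1$ if $W$ is unbounded). For a bounded Borel measurable function $f$ on $\mathbb{R}^d$, $H_Wf$ is the function on $\mathbb{R}^d$ with $H_Wf(x)=\int f\,d\mu_x^W$ for $x\in W$ (the generalized Dirichlet solution) and $H_Wf(x)=f(x)$ for $x\in\mathbb{R}^d\setminus W$. $1_E$ denotes the indicator function of $E$. A relatively closed subset $A$ of $U$ is unavoidable (in $U$) if $\mu_y^{U\setminus A}(A)=1$ for every $y\in U\setminus A$, that is, if $H_{U\setminus A}1_A=1$ on $U$. *)

theory Defs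
  imports "HOL-Probability.Probability"
begin

text \<open>
  Standard Brownian motion started at the origin, with all paths continuous. Brownian motion started
  at \<open>x\<close> is \<open>\<lambda>t \<omega>. x + B t \<omega>\<close>. Values of \<open>B\<close> at negative times are irrelevant.
\<close>

locale brownian_motion = prob_space M
  for M :: "'w measure" +
  fixes B :: "real \<Rightarrow> 'w \<Rightarrow> 'a::euclidean_space"
  assumes random_variable_B: "0 \<le> t \<Longrightarrow> random_variable borel (B t)"
    and start_origin: "\<omega> \<in> space M \<Longrightarrow> B 0 \<omega> = 0"
    and continuous_paths: "\<omega> \<in> space M \<Longrightarrow> continuous_on {0..} (\<lambda>t. B t \<omega>)"
    and independent_increments:
      "0 \<le> s 0 \<Longrightarrow> strict_mono s \<Longrightarrow>
        indep_vars (\<lambda>_. borel) (\<lambda>i \<omega>. B (s (Suc i)) \<omega> - B (s i) \<omega>) (UNIV :: nat set)"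
    and gaussian_increments:
      "0 \<le> s' \<Longrightarrow> s' < t \<Longrightarrow>
        distributed M lborel (\<lambda>\<omega>. B t \<omega> - B s' \<omega>)
          (\<lambda>y. ennreal (\<Prod>b\<in>Basis. normal_density 0 (sqrt (t - s')) (y \<bullet> b)))"

text \<open>Meaningful only for paths that leave \<open>W\<close>; otherwise the infimum is over the empty set.\<close>

definition exit_time ::
    "(real \<Rightarrow> 'w \<Rightarrow> 'a::euclidean_space) \<Rightarrow> 'a set \<Rightarrow> 'a \<Rightarrow> 'w \<Rightarrow> real" where
  "exit_time B W x \<omega> = Inf {t. 0 \<le> t \<and> x + B t \<omega> \<notin> W}"

text \<open>
  The distribution of the exit point. Restricting \<open>M\<close> to the paths that leave \<open>W\<close> in finite time
  gives total mass equal to the exit probability, which may be less than 1.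
\<close>

definition harmonic_measure ::
    "'w measure \<Rightarrow> (real \<Rightarrow> 'w \<Rightarrow> 'a::euclidean_space) \<Rightarrow> 'a set \<Rightarrow> 'a \<Rightarrow> 'a measure" where
  "harmonic_measure M B W x =
    distr (restrict_space M {\<omega> \<in> space M. \<exists>t\<ge>0. x + B t \<omega> \<notin> W}) borel
      (\<lambda>\<omega>. x + B (exit_time B W x \<omega>) \<omega>)"

definition dirichlet_solution ::
    "'w measure \<Rightarrow> (real \<Rightarrow> 'w \<Rightarrow> 'a::euclidean_space) \<Rightarrow> 'a set \<Rightarrow> ('a \<Rightarrow> real) \<Rightarrow> 'a \<Rightarrow> real" where
  "dirichlet_solution M B W f x =
    (if x \<in> W then (\<integral>y. f y \<partial>harmonic_measure M B W x) else f x)"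

definition unavoidable ::
    "'w measure \<Rightarrow> (real \<Rightarrow> 'w \<Rightarrow> 'a::euclidean_space) \<Rightarrow> 'a set \<Rightarrow> 'a set \<Rightarrow> bool" where
  "unavoidable M B U A \<longleftrightarrow>
    closedin (top_of_set U) A \<and>
    (\<forall>y\<in>U - A. emeasure (harmonic_measure M B (U - A) y) A = 1)"

end

theory Submission
  imports Defs
begin

text \<open>
  For \<open>E\<close> relatively closed in an open set \<open>V\<close>, the number \<open>H\<^bsub>V - E\<^esub>1\<^bsub>E\<^esub>(x)\<close> is the probability that Brownian motion
  started at \<open>x\<close> meets \<open>E\<close> before leaving \<open>V\<close>. If it starts at \<open>z \<in> \<partial>V\<^sub>n - A\<close>, it meets \<open>A\<close> before leaving
  \<open>V\<^sub>n\<^sub>+\<^sub>1\<close> with probability at least \<open>\<gamma>\<^sub>n\<close>; otherwise it leaves the bounded set \<open>V\<^sub>n\<^sub>+\<^sub>1\<close> through its boundary and,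
  by the strong Markov property, gets an independent chance there. Hence \<open>A\<close> is missed before the exit from
  \<open>V\<^sub>m\<close> with probability at most \<open>\<Prod>\<^bsub>n\<le>j<m\<^esub>(1 - \<gamma>\<^sub>j)\<close>.

  The strong Markov property at an exit time is obtained from discrete time. Along a dyadic grid the
  increments are independent and identically distributed, so resampling them after a stopping index does
  not change their law. The capped first grid times in an open neighbourhood of the complement of \<open>W\<close>
  converge, as the grid is refined, to the hitting time of that neighbourhood, and these hitting times
  increase to the exit time from \<open>W\<close> as the neighbourhood shrinks. Path continuity carries the joint law
  through both limits.
\<close>

section \<open>Hitting events and hitting times of paths\<close>

definition hits :: "'a set \<Rightarrow> 'a set \<Rightarrow> (real \<Rightarrow> 'a) \<Rightarrow> bool" where
  "hits F V p \<longleftrightarrow> (\<exists>t\<ge>0. p t \<in> F \<and> (\<forall>s\<in>{0..t}. p s \<in> V))"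

text \<open>Built from balls around points of \<open>F\<close> instead of \<open>infdist\<close>, so
  that it is empty for empty \<open>F\<close>. This makes \<open>V = UNIV\<close> a legitimate
  choice in \<open>hits_rat\<close>, as is needed for exit events.\<close>

definition nbhd :: "nat \<Rightarrow> 'a::metric_space set \<Rightarrow> 'a set" where
  "nbhd j F = (\<Union>u\<in>F. ball u (inverse (Suc j)))"

text \<open>
  The event \<^term>\<open>hits F V p\<close> read off from the values of a continuous path at the times \<open>\<bar>q\<bar>\<close>, \<open>q\<close>
  rational. Paths sampled this way live in the metrizable, second countable space \<open>rat \<Rightarrow> 'a\<close>, where
  the event is visibly Borel, jointly in the path and its starting point.
\<close>

definition hits_rat :: "'a::metric_space set \<Rightarrow> 'a set \<Rightarrow> (rat \<Rightarrow> 'a) \<Rightarrow> bool" where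
  "hits_rat F V w \<longleftrightarrow> (\<exists>j T::nat. \<forall>i. \<exists>q. \<bar>real_of_rat q\<bar> \<le> T \<and> w q \<in> nbhd i F \<and>
     (\<forall>r. \<bar>real_of_rat r\<bar> \<le> \<bar>real_of_rat q\<bar> \<longrightarrow> w r \<notin> nbhd j (- V)))"

lemma open_nbhd: "open (nbhd j F)"
  by (auto simp: nbhd_def)

lemma subset_nbhd: "F \<subseteq> nbhd j F"
  by (auto simp: nbhd_def)

lemma nbhd_antimono: "i \<le> j \<Longrightarrow> nbhd j F \<subseteq> nbhd i F"
  unfolding nbhd_def by (intro UN_mono order_refl subset_ball) (simp add: le_imp_inverse_le)

text \<open>Points of \<open>F\<close> within \<open>2 / (k i + 1)\<close> of \<open>x i\<close>
  have the same limit, and \<open>F\<close> is closed. It serves both for a subsequence of sampling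
  times and for a shrinking sequence of neighbourhoods.\<close>

lemma nbhd_limit:
  fixes x :: "nat \<Rightarrow> 'a::metric_space"
  assumes F: "closed F" and k: "filterlim k at_top sequentially"
    and x: "\<And>i. x i \<in> closure (nbhd (k i) F)" and l: "x \<longlonglongrightarrow> l"
  shows "l \<in> F"
proof -
  have "\<exists>u. u \<in> F \<and> dist (x i) u < 2 * inverse (Suc (k i))" for i
  proof -
    have "0 < inverse (real (Suc (k i)))" by simp
    then obtain z where z: "z \<in> nbhd (k i) F" "dist z (x i) < inverse (Suc (k i))"
      using x[of i] unfolding closure_approachable by blast
    then obtain u where u: "u \<in> F" "dist u z < inverse (Suc (k i))"
      by (auto simp: nbhd_def)
    have "dist (x i) u \<le> dist z (x i) + dist u z"
      by (metis dist_commute dist_triangle)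
    with z u show ?thesis by (intro exI[of _ u]) auto
  qed
  then obtain u where u: "\<And>i. u i \<in> F" "\<And>i. dist (x i) (u i) < 2 * inverse (Suc (k i))" by metis
  have inv: "(\<lambda>i. 2 * inverse (real (Suc (k i)))) \<longlonglongrightarrow> 2 * 0"
    by (intro tendsto_mult tendsto_const filterlim_compose[OF LIMSEQ_inverse_real_of_nat k])
  then have lim: "(\<lambda>i. 2 * inverse (real (Suc (k i))) + dist (x i) l) \<longlonglongrightarrow> 0"
    using tendsto_add[OF inv] l unfolding tendsto_dist_iff[of x] by fastforce
  have "dist (u i) l \<le> 2 * inverse (real (Suc (k i))) + dist (x i) l" for i
    using dist_triangle3[of "u i" l "x i"] u(2)[of i] by linarith
  then have "(\<lambda>i. dist (u i) l) \<longlonglongrightarrow> 0"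
    by (intro tendsto_sandwich[OF _ _ tendsto_const lim]) auto
  then have "u \<longlonglongrightarrow> l" by (rule iffD2[OF tendsto_dist_iff])
  with u(1) show ?thesis
    by (rule closed_sequentially[OF F])
qed

text \<open>A compact subset of \<open>V\<close> keeps a positive distance from the complement. For
  a path segment inside \<open>V\<close> this yields one \<open>j\<close> that is valid at all its
  times.\<close>

lemma compact_avoids_nbhd:
  fixes C :: "'a::metric_space set"
  assumes "compact C" "open V" "C \<subseteq> V"
  obtains j where "C \<inter> nbhd j (- V) = {}"
proof -
  obtain e where e: "e > 0" "(\<Union>x\<in>C. ball x e) \<subseteq> V"
    using compact_subset_open_imp_ball_epsilon_subset[OF assms] by blast
  obtain j where j: "inverse (real (Suc j)) < e"
    using reals_Archimedean[OF e(1)] by blast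
  have "C \<inter> nbhd j (- V) = {}"
  proof (rule ccontr)
    assume "C \<inter> nbhd j (- V) \<noteq> {}"
    then obtain c u where "c \<in> C" "u \<notin> V" "dist u c < inverse (Suc j)"
      by (auto simp: nbhd_def)
    with j have "u \<in> ball c e" by (simp add: dist_commute)
    with e(2) \<open>c \<in> C\<close> \<open>u \<notin> V\<close> show False by blast
  qed
  then show ?thesis by (rule that)
qed

text \<open>Approximation from the left keeps the sampled times in the part of the path whose
  position is already controlled.\<close>

lemma rat_seq_below:
  assumes "0 < (t::real)"
  obtains q :: "nat \<Rightarrow> rat" where "\<And>n. 0 \<le> real_of_rat (q n)" "\<And>n. real_of_rat (q n) < t"
    "(\<lambda>n. real_of_rat (q n)) \<longlonglongrightarrow> t"
proof -
  have "\<exists>q. max 0 (t - inverse (Suc n)) < real_of_rat q \<and> real_of_rat q < t" for n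
    using assms by (intro of_rat_dense) auto
  then obtain q where q: "\<And>n. max 0 (t - inverse (Suc n)) < real_of_rat (q n)" "\<And>n. real_of_rat (q n) < t"
    by metis
  have "(\<lambda>n. t - inverse (real (Suc n))) \<longlonglongrightarrow> t - 0"
    by (intro tendsto_intros LIMSEQ_inverse_real_of_nat)
  then have lim: "(\<lambda>n. t - inverse (real (Suc n))) \<longlonglongrightarrow> t" by simp
  have "t - inverse (real (Suc n)) \<le> real_of_rat (q n)" for n
    using q(1)[of n] by linarith
  with q(2) have "(\<lambda>n. real_of_rat (q n)) \<longlonglongrightarrow> t"
    by (intro tendsto_sandwich[OF _ _ lim tendsto_const] always_eventually) (auto intro: less_imp_le)
  with q show ?thesis by (intro that[of q]) (auto intro: less_imp_le)
qed

text \<open>If the path hits at time \<open>t\<close>, compactness of its image on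
  \<open>{0..t}\<close> gives a single \<open>j\<close>, and rational times near \<open>t\<close>
  enter every \<open>nbhd i F\<close>. Conversely, the rational times have a limit point, at which
  continuity puts the path into \<open>F\<close>; all earlier positions are limits of samples
  outside the open set \<open>nbhd j (- V)\<close>.\<close>

lemma hits_rat_iff:
  fixes p :: "real \<Rightarrow> 'a::metric_space"
  assumes p: "continuous_on {0..} p" and F: "closed F" and V: "open V"
  shows "hits_rat F V (\<lambda>q. p \<bar>real_of_rat q\<bar>) \<longleftrightarrow> hits F V p"
proof
  assume "hits F V p"
  then obtain t where t: "0 \<le> t" "p t \<in> F" "\<And>s. s \<in> {0..t} \<Longrightarrow> p s \<in> V"
    by (auto simp: hits_def)
  have "compact (p ` {0..t})" "p ` {0..t} \<subseteq> V"
    using t by (auto intro!: compact_continuous_image continuous_on_subset[OF p])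
  with V obtain j where j: "p ` {0..t} \<inter> nbhd j (- V) = {}"
    using compact_avoids_nbhd by blast
  obtain T :: nat where T: "t \<le> T" using real_arch_simple by blast
  have near: "\<exists>q. \<bar>real_of_rat q\<bar> \<le> t \<and> p \<bar>real_of_rat q\<bar> \<in> nbhd i F" for i
  proof (cases "t = 0")
    case True
    then show ?thesis using t subset_nbhd[of F i] by (intro exI[of _ 0]) auto
  next
    case False
    with t obtain q where q: "\<And>n. 0 \<le> real_of_rat (q n)" "\<And>n. real_of_rat (q n) < t"
      "(\<lambda>n. real_of_rat (q n)) \<longlonglongrightarrow> t" using rat_seq_below[of t] by auto
    have "(\<lambda>n. p (real_of_rat (q n))) \<longlonglongrightarrow> p t"
      using q t by (intro continuous_on_tendsto_compose[OF p]) auto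
    then have "\<forall>\<^sub>F n in sequentially. p (real_of_rat (q n)) \<in> nbhd i F"
      by (rule topological_tendstoD) (use t subset_nbhd in \<open>auto simp: open_nbhd\<close>)
    then obtain n where "p (real_of_rat (q n)) \<in> nbhd i F"
      by (auto simp: eventually_sequentially)
    with q show ?thesis by (intro exI[of _ "q n"]) (auto intro: less_imp_le)
  qed
  have away: "p \<bar>real_of_rat r\<bar> \<notin> nbhd j (- V)" if "\<bar>real_of_rat r\<bar> \<le> t" for r
  proof -
    have "p \<bar>real_of_rat r\<bar> \<in> p ` {0..t}" using that by (intro imageI) simp
    with j show ?thesis by blast
  qed
  have "\<exists>q. \<bar>real_of_rat q\<bar> \<le> real T \<and> p \<bar>real_of_rat q\<bar> \<in> nbhd i F \<and>
      (\<forall>r. \<bar>real_of_rat r\<bar> \<le> \<bar>real_of_rat q\<bar> \<longrightarrow> p \<bar>real_of_rat r\<bar> \<notin> nbhd j (- V))" for i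
  proof -
    obtain q where q: "\<bar>real_of_rat q\<bar> \<le> t" "p \<bar>real_of_rat q\<bar> \<in> nbhd i F" using near by blast
    show ?thesis
      by (intro exI[of _ q] conjI allI impI away order_trans[OF q(1) T] q(2))
        (erule order_trans[OF _ q(1)])
  qed
  then show "hits_rat F V (\<lambda>q. p \<bar>real_of_rat q\<bar>)"
    unfolding hits_rat_def by blast
next
  assume "hits_rat F V (\<lambda>q. p \<bar>real_of_rat q\<bar>)"
  then obtain j and T :: nat where "\<forall>i. \<exists>q. \<bar>real_of_rat q\<bar> \<le> real T \<and> p \<bar>real_of_rat q\<bar> \<in> nbhd i F \<and>
      (\<forall>r. \<bar>real_of_rat r\<bar> \<le> \<bar>real_of_rat q\<bar> \<longrightarrow> p \<bar>real_of_rat r\<bar> \<notin> nbhd j (- V))"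
    unfolding hits_rat_def by blast
  then obtain q where q: "\<And>i. \<bar>real_of_rat (q i)\<bar> \<le> real T" "\<And>i. p \<bar>real_of_rat (q i)\<bar> \<in> nbhd i F"
    "\<And>i r. \<bar>real_of_rat r\<bar> \<le> \<bar>real_of_rat (q i)\<bar> \<Longrightarrow> p \<bar>real_of_rat r\<bar> \<notin> nbhd j (- V)"
    by metis
  \<comment> \<open>The common bound \<open>T\<close> puts these approximate hitting times into a
    compact interval; any limit point is a time at which \<open>F\<close> is met.\<close>
  define \<tau> where "\<tau> i = \<bar>real_of_rat (q i)\<bar>" for i
  have "compact {0..real T}" "\<forall>i. \<tau> i \<in> {0..real T}" using q by (auto simp: \<tau>_def)
  then obtain t k where t: "t \<in> {0..real T}" and k: "strict_mono k" "(\<tau> \<circ> k) \<longlonglongrightarrow> t"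
    unfolding compact_def by metis
  have "(\<lambda>i. p (\<tau> (k i))) \<longlonglongrightarrow> p t"
    using t k by (intro continuous_on_tendsto_compose[OF p]) (auto simp: \<tau>_def o_def)
  then have "p t \<in> F"
    using q(2) by (intro nbhd_limit[OF F filterlim_subseq[OF k(1)]]) (auto simp: \<tau>_def intro: closure_subset[THEN subsetD])
  moreover have "p s \<in> V" if s: "s \<in> {0..t}" for s
  proof -
    have "p s \<in> - nbhd j (- V)"
    proof (cases "s = 0")
      case True
      then show ?thesis using q(3)[of 0 0] by auto
    next
      case False
      with s have "0 < s" by auto
      then obtain r where r: "\<And>n. 0 \<le> real_of_rat (r n)" "\<And>n. real_of_rat (r n) < s"
        "(\<lambda>n. real_of_rat (r n)) \<longlonglongrightarrow> s" using rat_seq_below by blast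
      \<comment> \<open>Since \<open>r n\<close> lies strictly below \<open>t\<close>, some
        \<open>\<tau> (k i)\<close> exceeds it, and the avoidance clause for that index covers
        \<open>r n\<close>.\<close>
      have "p (real_of_rat (r n)) \<in> - nbhd j (- V)" for n
      proof -
        have "real_of_rat (r n) < t" using r(2)[of n] s by auto
        with k(2) have "\<forall>\<^sub>F i in sequentially. real_of_rat (r n) < (\<tau> \<circ> k) i"
          by (auto dest: order_tendstoD(1))
        then obtain i where "real_of_rat (r n) < \<tau> (k i)" by (auto simp: eventually_sequentially)
        with r(1)[of n] q(3)[of "r n" "k i"] show ?thesis by (auto simp: \<tau>_def)
      qed
      moreover have "(\<lambda>n. p (real_of_rat (r n))) \<longlonglongrightarrow> p s"
        using r s by (intro continuous_on_tendsto_compose[OF p]) auto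
      ultimately show ?thesis
        by (rule closed_sequentially[OF closed_Compl[OF open_nbhd]])
    qed
    then show "p s \<in> V" using subset_nbhd[of "- V" j] by auto
  qed
  ultimately show "hits F V p" using t by (auto simp: hits_def)
qed

text \<open>The infimum of the empty set, an unspecified real, if \<open>p\<close> never meets \<open>C\<close>.\<close>

definition hit_time :: "'a set \<Rightarrow> (real \<Rightarrow> 'a) \<Rightarrow> real" where
  "hit_time C p = Inf {t. 0 \<le> t \<and> p t \<in> C}"

lemma hit_time_le: "0 \<le> t \<Longrightarrow> p t \<in> C \<Longrightarrow> hit_time C p \<le> t"
  unfolding hit_time_def by (rule cInf_lower) (auto intro: bdd_belowI[of _ 0])

lemma hit_time_nonneg: "\<exists>t\<ge>0. p t \<in> C \<Longrightarrow> 0 \<le> hit_time C p"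
  unfolding hit_time_def by (rule cInf_greatest) auto

lemma hit_time_lessE:
  assumes "\<exists>t\<ge>0. p t \<in> C" "hit_time C p < u"
  obtains t where "0 \<le> t" "p t \<in> C" "hit_time C p \<le> t" "t < u"
proof -
  have "{t. 0 \<le> t \<and> p t \<in> C} \<noteq> {}" using assms by auto
  from cInf_lessD[OF this] assms(2) obtain t where "0 \<le> t" "p t \<in> C" "t < u"
    unfolding hit_time_def by auto
  then show ?thesis using that hit_time_le by metis
qed

lemma not_before_hit_time: "0 \<le> s \<Longrightarrow> s < hit_time C p \<Longrightarrow> p s \<notin> C"
  using hit_time_le[of s p C] by auto

text \<open>The infimum is a limit of times spent in \<open>C\<close>. Only the closure can be
  reached in general: a path entering an open set does so through its boundary.\<close>

lemma hit_time_in_closure: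
  fixes p :: "real \<Rightarrow> 'a::metric_space"
  assumes p: "continuous_on {0..} p" and ex: "\<exists>t\<ge>0. p t \<in> C"
  shows "p (hit_time C p) \<in> closure C"
proof -
  let ?S = "{t. 0 \<le> t \<and> p t \<in> C}"
  have "hit_time C p \<in> closure ?S"
    unfolding hit_time_def using ex by (intro closure_contains_Inf) (auto intro: bdd_belowI[of _ 0])
  then obtain x where x: "\<And>n. x n \<in> ?S" "x \<longlonglongrightarrow> hit_time C p"
    unfolding closure_sequential by auto
  have "(\<lambda>n. p (x n)) \<longlonglongrightarrow> p (hit_time C p)"
    using x by (intro continuous_on_tendsto_compose[OF p]) (auto simp: hit_time_nonneg[OF ex])
  moreover have "\<forall>n. p (x n) \<in> C" using x(1) by auto
  ultimately show ?thesis
    unfolding closure_sequential by (intro exI[of _ "\<lambda>n. p (x n)"]) auto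
qed

text \<open>The times increase with \<open>j\<close> and stay below \<open>hit_time C p\<close>. At
  their limit \<open>l\<close> the path lies in every neighbourhood's limit, hence in the closed set
  \<open>C\<close>, so \<open>l\<close> cannot be smaller than the hitting time.\<close>

lemma hit_time_nbhd_tendsto:
  fixes p :: "real \<Rightarrow> 'a::metric_space"
  assumes p: "continuous_on {0..} p" and C: "closed C" and ex: "\<exists>t\<ge>0. p t \<in> C"
  shows "(\<lambda>j. hit_time (nbhd j C) p) \<longlonglongrightarrow> hit_time C p"
proof -
  define \<tau> where "\<tau> j = hit_time (nbhd j C) p" for j
  have exj: "\<exists>t\<ge>0. p t \<in> nbhd j C" for j using ex subset_nbhd[of C j] by blast
  have mono: "\<tau> i \<le> \<tau> j" if "i \<le> j" for i j
    unfolding \<tau>_def hit_time_def using nbhd_antimono[OF that, of C] exj[of j]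
    by (intro cInf_superset_mono) (auto intro: bdd_belowI[of _ 0])
  have le: "\<tau> j \<le> hit_time C p" for j
    unfolding \<tau>_def hit_time_def using subset_nbhd[of C j] ex
    by (intro cInf_superset_mono) (auto intro: bdd_belowI[of _ 0])
  obtain l where l: "\<tau> \<longlonglongrightarrow> l" "\<And>j. \<tau> j \<le> l"
    using incseq_convergent[of \<tau> "hit_time C p"] mono le by (auto simp: incseq_def)
  have nn: "0 \<le> \<tau> j" for j unfolding \<tau>_def by (rule hit_time_nonneg[OF exj])
  have l0: "0 \<le> l" using nn l(2) order_trans by blast
  have "(\<lambda>j. p (\<tau> j)) \<longlonglongrightarrow> p l"
    using l nn l0 by (intro continuous_on_tendsto_compose[OF p]) auto
  then have "p l \<in> C"
    using hit_time_in_closure[OF p exj] by (intro nbhd_limit[OF C filterlim_ident]) (auto simp: \<tau>_def)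
  then have "hit_time C p \<le> l" using l0 by (rule hit_time_le[rotated])
  moreover have "l \<le> hit_time C p" using LIMSEQ_le_const2[OF l(1)] le by blast
  ultimately have "l = hit_time C p" by simp
  with l(1) show ?thesis unfolding \<tau>_def by simp
qed

text \<open>The bound \<open>N\<close> makes the index finite even for paths that never meet \<open>C\<close> on the grid.\<close>

definition grid_index :: "nat \<Rightarrow> 'a set \<Rightarrow> (nat \<Rightarrow> 'a) \<Rightarrow> nat" where
  "grid_index N C g = (LEAST i. N \<le> i \<or> g i \<in> C)"

lemma grid_index_eq_iff:
  "grid_index N C g = p \<longleftrightarrow> (N \<le> p \<or> g p \<in> C) \<and> (\<forall>i<p. \<not> (N \<le> i \<or> g i \<in> C))"
proof
  assume p: "grid_index N C g = p"
  have "N \<le> p \<or> g p \<in> C"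
    unfolding p[symmetric] grid_index_def by (rule LeastI[of _ N]) simp
  moreover have "\<not> (N \<le> i \<or> g i \<in> C)" if "i < p" for i
    using that unfolding p[symmetric] grid_index_def by (rule not_less_Least)
  ultimately show "(N \<le> p \<or> g p \<in> C) \<and> (\<forall>i<p. \<not> (N \<le> i \<or> g i \<in> C))" by blast
next
  assume "(N \<le> p \<or> g p \<in> C) \<and> (\<forall>i<p. \<not> (N \<le> i \<or> g i \<in> C))"
  then show "grid_index N C g = p"
    unfolding grid_index_def by (intro Least_equality) (auto simp: not_less[symmetric])
qed

lemma grid_index_measurable:
  assumes g [measurable]: "\<And>i. g i \<in> borel_measurable M" and C [measurable]: "C \<in> sets borel"
  shows "(\<lambda>\<omega>. grid_index N C (\<lambda>i. g i \<omega>)) \<in> measurable M (count_space UNIV)"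
proof (rule measurable_count_space_eq2_countable[THEN iffD2], intro conjI ballI)
  fix p :: nat
  have "(\<lambda>\<omega>. grid_index N C (\<lambda>i. g i \<omega>)) -` {p} \<inter> space M =
      {\<omega> \<in> space M. (N \<le> p \<or> g p \<omega> \<in> C) \<and> (\<forall>i<p. \<not> (N \<le> i \<or> g i \<omega> \<in> C))}"
    by (simp add: vimage_def Int_def grid_index_eq_iff conj_commute)
  also have "\<dots> \<in> sets M" by measurable
  finally show "(\<lambda>\<omega>. grid_index N C (\<lambda>i. g i \<omega>)) -` {p} \<inter> space M \<in> sets M" .
qed auto

section \<open>Dyadic approximation of hitting times\<close>

lemma dyadic_above: "t \<le> real (nat \<lceil>t * 2^k\<rceil>) / 2^k"
proof -
  have "t * 2^k \<le> real (nat \<lceil>t * 2^k\<rceil>)" by linarith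
  then show ?thesis by (simp add: pos_le_divide_eq)
qed

lemma dyadic_tendsto:
  assumes "0 \<le> t"
  shows "(\<lambda>k. real (nat \<lceil>t * 2^k\<rceil>) / 2^k) \<longlonglongrightarrow> t"
proof -
  have le: "real (nat \<lceil>t * 2^k\<rceil>) / 2^k \<le> t + inverse (2^k)" for k
  proof -
    have "real (nat \<lceil>t * 2^k\<rceil>) = of_int \<lceil>t * 2^k\<rceil>" using assms by simp
    then have "real (nat \<lceil>t * 2^k\<rceil>) \<le> t * 2^k + 1" by linarith
    then show ?thesis by (simp add: field_simps)
  qed
  have "(\<lambda>k. t + inverse (2^k)) \<longlonglongrightarrow> t + 0"
    by (intro tendsto_intros LIMSEQ_inverse_realpow_zero) auto
  then have "(\<lambda>k. t + inverse (2^k)) \<longlonglongrightarrow> t" by simp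
  from tendsto_sandwich[OF _ _ tendsto_const this] show ?thesis
    by (simp add: dyadic_above le)
qed

text \<open>Grid times in \<open>C\<close> are never earlier than the hitting time. Conversely, as
  \<open>C\<close> is open, a visit at time \<open>t\<close> persists at the dyadic points just
  above \<open>t\<close> once the grid is fine. The cap \<open>k * 2^k\<close> corresponds to the
  time horizon \<open>k\<close>, which eventually exceeds the hitting time.\<close>

lemma hit_time_grid_tendsto:
  fixes p :: "real \<Rightarrow> 'a::metric_space"
  assumes p: "continuous_on {0..} p" and C: "open C" and ex: "\<exists>t\<ge>0. p t \<in> C"
  shows "(\<lambda>k. grid_index (k * 2^k) C (\<lambda>i. p (i / 2^k)) / 2^k) \<longlonglongrightarrow> hit_time C p"
proof -
  define \<nu> where "\<nu> k = grid_index (k * 2^k) C (\<lambda>i. p (i / 2^k))" for k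
  let ?\<tau> = "hit_time C p"
  have \<nu>: "k * 2^k \<le> \<nu> k \<or> p (\<nu> k / 2^k) \<in> C" for k
    unfolding \<nu>_def grid_index_def by (rule LeastI[of _ "k * 2^k"]) simp
  have \<nu>_le: "\<nu> k \<le> i" if "p (i / 2^k) \<in> C" for k i
    unfolding \<nu>_def grid_index_def by (rule Least_le) (simp add: that)
  have lower: "?\<tau> \<le> \<nu> k / 2^k" if "?\<tau> \<le> k" for k
    using \<nu>[of k]
  proof
    assume "k * 2^k \<le> \<nu> k"
    then have "real k * 2^k \<le> real (\<nu> k)"
      using of_nat_mono[of "k * 2^k" "\<nu> k", where 'a = real] by simp
    then have "real k \<le> \<nu> k / 2^k" by (simp add: pos_le_divide_eq)
    with that show ?thesis by linarith
  qed (auto intro: hit_time_le)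
  have upper: "\<forall>\<^sub>F k in sequentially. \<nu> k / 2^k < u" if "?\<tau> < u" for u
  proof -
    obtain t where t: "0 \<le> t" "p t \<in> C" "t < u" using hit_time_lessE[OF ex \<open>?\<tau> < u\<close>] by metis
    define g where "g k = real (nat \<lceil>t * 2^k\<rceil>) / 2^k" for k
    have g: "t \<le> g k" for k unfolding g_def by (rule dyadic_above)
    have gt: "g \<longlonglongrightarrow> t" unfolding g_def[abs_def] by (rule dyadic_tendsto[OF t(1)])
    then have "(\<lambda>k. p (g k)) \<longlonglongrightarrow> p t"
      using gt t(1) order_trans[OF t(1) g] by (intro continuous_on_tendsto_compose[OF p]) auto
    then have "\<forall>\<^sub>F k in sequentially. p (g k) \<in> C"
      using C t(2) by (rule topological_tendstoD)
    moreover have "\<forall>\<^sub>F k in sequentially. g k < u"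
      using gt t(3) by (rule order_tendstoD)
    ultimately show ?thesis
    proof eventually_elim
      case (elim k)
      then have "\<nu> k \<le> nat \<lceil>t * 2^k\<rceil>" by (intro \<nu>_le) (simp add: g_def)
      then have "\<nu> k / 2^k \<le> g k" by (simp add: g_def divide_right_mono)
      with elim show ?case by simp
    qed
  qed
  have "\<forall>\<^sub>F k in sequentially. ?\<tau> \<le> real k"
    using filterlim_real_sequentially unfolding filterlim_at_top by blast
  then have ev: "\<forall>\<^sub>F k in sequentially. ?\<tau> \<le> \<nu> k / 2^k" by eventually_elim (rule lower)
  have "(\<lambda>k. \<nu> k / 2^k) \<longlonglongrightarrow> ?\<tau>"
  proof (rule order_tendstoI)
    fix a assume "a < ?\<tau>"
    then show "\<forall>\<^sub>F k in sequentially. a < \<nu> k / 2^k"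
      by (intro eventually_mono[OF ev]) auto
  qed (rule upper)
  then show ?thesis by (simp add: \<nu>_def)
qed

text \<open>All quantifiers in \<open>hits_rat\<close> range over naturals or rationals, so the
  event is a countable combination of preimages of open sets.\<close>

lemma hits_rat_measurable:
  fixes F V :: "'a::euclidean_space set"
  assumes w: "\<And>q. (\<lambda>\<omega>. w \<omega> q) \<in> borel_measurable M"
  shows "{\<omega> \<in> space M. hits_rat F V (w \<omega>)} \<in> sets M"
proof -
  note [measurable] = w borel_open[OF open_nbhd]
  show ?thesis unfolding hits_rat_def by measurable
qed

text \<open>Applied with \<open>T\<close> an exit time from a subset of \<open>V\<close>: a hit by
  the restarted path is then a hit by the whole path.\<close>

lemma hits_shift:
  assumes "hits F V (\<lambda>t. p (T + t))" "0 \<le> T" "\<And>s. 0 \<le> s \<Longrightarrow> s < T \<Longrightarrow> p s \<in> V"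
  shows "hits F V p"
proof -
  obtain t where t: "0 \<le> t" "p (T + t) \<in> F" "\<And>s. s \<in> {0..t} \<Longrightarrow> p (T + s) \<in> V"
    using assms(1) by (auto simp: hits_def)
  have "p s \<in> V" if "s \<in> {0..T + t}" for s
  proof (cases "s < T")
    case False
    with that t(3)[of "s - T"] show ?thesis by auto
  qed (use that assms(3) in auto)
  with t assms(2) show ?thesis unfolding hits_def by (intro exI[of _ "T + t"]) auto
qed

section \<open>Joint laws and resampling\<close>

text \<open>The indicator of an open set is the pointwise limit of continuous functions with values
  in the unit interval, and the open sets are an intersection-stable generator.\<close>

lemma measure_eqI_continuous:
  fixes P Q :: "'z::metric_space measure"
  assumes P: "finite_measure P" "sets P = sets borel" and Q: "finite_measure Q" "sets Q = sets borel"
    and eq: "\<And>f::'z \<Rightarrow> real. continuous_on UNIV f \<Longrightarrow> (\<And>x. 0 \<le> f x \<and> f x \<le> 1) \<Longrightarrow>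
      (\<integral>x. f x \<partial>P) = (\<integral>x. f x \<partial>Q)"
  shows "P = Q"
proof -
  interpret P: finite_measure P by fact
  interpret Q: finite_measure Q by fact
  have [measurable_cong]: "sets P = sets borel" "sets Q = sets borel" by fact+
  have open_eq: "emeasure P G = emeasure Q G" if G: "open G" for G
  proof -
    \<comment> \<open>The case \<open>G = UNIV\<close> is separate because \<open>infdist\<close> to
      the empty set is 0 by convention.\<close>
    define f where "f n x = (if G = UNIV then 1 else min 1 (real n * infdist x (- G)))" for n :: nat and x
    have cont: "continuous_on UNIV (f n)" for n
      unfolding f_def by (cases "G = UNIV") (auto intro!: continuous_intros)
    then have [measurable]: "f n \<in> borel_measurable borel" for n
      by (rule borel_measurable_continuous_onI)
    have bounds: "0 \<le> f n x \<and> f n x \<le> 1" for n x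
      by (auto simp: f_def infdist_nonneg)
    have [measurable]: "G \<in> sets borel" using G by simp
    have lim: "(\<lambda>n. f n x) \<longlonglongrightarrow> indicator G x" for x
    proof (cases "x \<in> G \<and> G \<noteq> UNIV")
      case True
      then have "0 < infdist x (- G)"
        using G by (intro infdist_pos_not_in_closed) auto
      then obtain N where N: "1 < real N * infdist x (- G)"
        using reals_Archimedean3 by blast
      have "f n x = 1" if "N \<le> n" for n
      proof -
        have "real N * infdist x (- G) \<le> real n * infdist x (- G)"
          using that by (intro mult_right_mono) (auto simp: infdist_nonneg)
        with N True show ?thesis by (simp add: f_def)
      qed
      then show ?thesis
        using True by (intro tendsto_eventually eventually_sequentiallyI[of N]) auto
    next
      case False
      then have "f n x = indicator G x" for n by (auto simp: f_def)
      then show ?thesis by simp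
    qed
    have "(\<lambda>n. \<integral>x. f n x \<partial>P) \<longlonglongrightarrow> (\<integral>x. indicator G x \<partial>P)"
      using bounds lim by (intro integral_dominated_convergence[where w = "\<lambda>_. 1"]) auto
    moreover have "(\<lambda>n. \<integral>x. f n x \<partial>Q) \<longlonglongrightarrow> (\<integral>x. indicator G x \<partial>Q)"
      using bounds lim by (intro integral_dominated_convergence[where w = "\<lambda>_. 1"]) auto
    moreover have "(\<integral>x. f n x \<partial>P) = (\<integral>x. f n x \<partial>Q)" for n
      using cont bounds by (rule eq)
    ultimately have "measure P G = measure Q G"
      using LIMSEQ_unique by fastforce
    then show ?thesis
      by (simp add: P.emeasure_eq_measure Q.emeasure_eq_measure)
  qed
  show ?thesis
  proof (rule measure_eqI_generator_eq[where E = "{G. open G}" and \<Omega> = UNIV and A = "\<lambda>_. UNIV"])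
    show "sets P = sigma_sets UNIV {G. open G}" "sets Q = sigma_sets UNIV {G. open G}"
      using P Q by (simp_all add: borel_def)
    show "emeasure P UNIV \<noteq> \<infinity>" for i :: nat by simp
  qed (auto simp: Int_stable_def open_eq)
qed

text \<open>For a countable index type and a second countable space, the Borel sets of the product
  topology are generated by the coordinates.\<close>

lemma measurable_Pair_borel:
  fixes Y :: "'w \<Rightarrow> 'a::second_countable_topology" and X :: "'w \<Rightarrow> 'i::countable \<Rightarrow> 'a"
  assumes Y: "Y \<in> borel_measurable M" and X: "\<And>q. (\<lambda>\<omega>. X \<omega> q) \<in> borel_measurable M"
  shows "(\<lambda>\<omega>. (Y \<omega>, X \<omega>)) \<in> borel_measurable M"
  unfolding borel_prod[symmetric]
  by (intro measurable_Pair Y measurable_coordinatewise_then_product X)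

text \<open>Identity in law passes to almost sure limits: test with bounded continuous functions and
  use dominated convergence on both sides. Convergence of each coordinate is convergence in the
  product topology.\<close>

lemma (in prob_space) joint_law_limit:
  fixes Y :: "'a \<Rightarrow> 'b::{metric_space, second_countable_topology}" and X X' :: "'a \<Rightarrow> 'i::countable \<Rightarrow> 'b"
  assumes meas: "\<And>k. Y\<^sub>n k \<in> borel_measurable M" "\<And>k q. (\<lambda>\<omega>. X\<^sub>n k \<omega> q) \<in> borel_measurable M"
      "\<And>k q. (\<lambda>\<omega>. X'\<^sub>n k \<omega> q) \<in> borel_measurable M"
      "Y \<in> borel_measurable M" "\<And>q. (\<lambda>\<omega>. X \<omega> q) \<in> borel_measurable M"
      "\<And>q. (\<lambda>\<omega>. X' \<omega> q) \<in> borel_measurable M"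
    and eq: "\<And>k. distr M borel (\<lambda>\<omega>. (Y\<^sub>n k \<omega>, X\<^sub>n k \<omega>)) =
      distr (M \<Otimes>\<^sub>M M) borel (\<lambda>(\<omega>, \<omega>'). (Y\<^sub>n k \<omega>, X'\<^sub>n k \<omega>'))"
    and lim: "AE \<omega> in M. (\<lambda>k. Y\<^sub>n k \<omega>) \<longlonglongrightarrow> Y \<omega>" "AE \<omega> in M. \<forall>q. (\<lambda>k. X\<^sub>n k \<omega> q) \<longlonglongrightarrow> X \<omega> q"
      "AE \<omega> in M. \<forall>q. (\<lambda>k. X'\<^sub>n k \<omega> q) \<longlonglongrightarrow> X' \<omega> q"
  shows "distr M borel (\<lambda>\<omega>. (Y \<omega>, X \<omega>)) = distr (M \<Otimes>\<^sub>M M) borel (\<lambda>(\<omega>, \<omega>'). (Y \<omega>, X' \<omega>'))"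
proof -
  interpret MM: pair_prob_space M M ..
  note [measurable] = meas
  have m1 [measurable]: "(\<lambda>\<omega>. (Y\<^sub>n k \<omega>, X\<^sub>n k \<omega>)) \<in> borel_measurable M" for k
    by (intro measurable_Pair_borel meas)
  have m2 [measurable]: "(\<lambda>\<omega>. (Y \<omega>, X \<omega>)) \<in> borel_measurable M"
    by (intro measurable_Pair_borel meas)
  have m3 [measurable]: "(\<lambda>(\<omega>, \<omega>'). (Y\<^sub>n k \<omega>, X'\<^sub>n k \<omega>')) \<in> borel_measurable (M \<Otimes>\<^sub>M M)" for k
    unfolding case_prod_beta by (intro measurable_Pair_borel) measurable
  have m4 [measurable]: "(\<lambda>(\<omega>, \<omega>'). (Y \<omega>, X' \<omega>')) \<in> borel_measurable (M \<Otimes>\<^sub>M M)"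
    unfolding case_prod_beta by (intro measurable_Pair_borel) measurable
  \<comment> \<open>Almost sure statements lift to the product because both projections have law
    \<open>M\<close>.\<close>
  have AE_fst: "AE z in M \<Otimes>\<^sub>M M. R (fst z)" if "AE \<omega> in M. R \<omega>" for R
    using that by (intro AE_distrD[OF measurable_fst, where M' = M]) (subst distr_pair_fst)
  have "distr (M \<Otimes>\<^sub>M M) M snd = distr (distr (M \<Otimes>\<^sub>M M) (M \<Otimes>\<^sub>M M) (\<lambda>(x, y). (y, x))) M fst"
    by (subst distr_distr) (auto simp: comp_def case_prod_beta)
  also have "\<dots> = M"
    by (subst MM.distr_pair_swap[symmetric]) (rule distr_pair_fst)
  finally have snd_eq: "distr (M \<Otimes>\<^sub>M M) M snd = M" .
  have AE_snd: "AE z in M \<Otimes>\<^sub>M M. R (snd z)" if "AE \<omega> in M. R \<omega>" for R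
    using that by (intro AE_distrD[OF measurable_snd, where M' = M]) (subst snd_eq)
  show ?thesis
  proof (rule measure_eqI_continuous)
    fix f :: "'b \<times> ('i \<Rightarrow> 'b) \<Rightarrow> real"
    assume f: "continuous_on UNIV f" "\<And>x. 0 \<le> f x \<and> f x \<le> 1"
    have [measurable]: "f \<in> borel_measurable borel" using f(1) by (rule borel_measurable_continuous_onI)
    have f_lim: "(\<lambda>k. f (y k, x k)) \<longlonglongrightarrow> f (y', x')"
      if "y \<longlonglongrightarrow> y'" "\<forall>q. (\<lambda>k. x k q) \<longlonglongrightarrow> x' q" for y x y' x'
    proof -
      have "limitin (product_topology (\<lambda>_. euclidean) UNIV) x x' sequentially"
        using that(2) by (auto simp: limitin_componentwise)
      then have "x \<longlonglongrightarrow> x'" by (simp add: euclidean_product_topology)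
      then show ?thesis
        using that(1) by (intro continuous_on_tendsto_compose[OF f(1)] tendsto_Pair) auto
    qed
    have "(\<lambda>k. \<integral>\<omega>. f (Y\<^sub>n k \<omega>, X\<^sub>n k \<omega>) \<partial>M) \<longlonglongrightarrow> (\<integral>\<omega>. f (Y \<omega>, X \<omega>) \<partial>M)"
    proof (rule integral_dominated_convergence[where w = "\<lambda>_. 1"])
      show "AE \<omega> in M. (\<lambda>k. f (Y\<^sub>n k \<omega>, X\<^sub>n k \<omega>)) \<longlonglongrightarrow> f (Y \<omega>, X \<omega>)"
        using lim(1,2) by eventually_elim (rule f_lim)
    qed (use f in auto)
    moreover have "(\<lambda>k. \<integral>z. f (Y\<^sub>n k (fst z), X'\<^sub>n k (snd z)) \<partial>(M \<Otimes>\<^sub>M M)) \<longlonglongrightarrow>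
        (\<integral>z. f (Y (fst z), X' (snd z)) \<partial>(M \<Otimes>\<^sub>M M))"
    proof (rule integral_dominated_convergence[where w = "\<lambda>_. 1"])
      show "AE z in M \<Otimes>\<^sub>M M. (\<lambda>k. f (Y\<^sub>n k (fst z), X'\<^sub>n k (snd z))) \<longlonglongrightarrow> f (Y (fst z), X' (snd z))"
        using AE_fst[OF lim(1)] AE_snd[OF lim(3)] by eventually_elim (rule f_lim)
    qed (use f m3 m4 in \<open>auto simp: case_prod_beta\<close>)
    moreover have "(\<integral>\<omega>. f (Y\<^sub>n k \<omega>, X\<^sub>n k \<omega>) \<partial>M) =
        (\<integral>z. f (Y\<^sub>n k (fst z), X'\<^sub>n k (snd z)) \<partial>(M \<Otimes>\<^sub>M M))" for k
      using arg_cong[OF eq[of k], of "\<lambda>N. \<integral>z. f z \<partial>N"]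
      by (simp add: integral_distr case_prod_beta)
    ultimately show "(\<integral>z. f z \<partial>distr M borel (\<lambda>\<omega>. (Y \<omega>, X \<omega>))) =
        (\<integral>z. f z \<partial>distr (M \<Otimes>\<^sub>M M) borel (\<lambda>(\<omega>, \<omega>'). (Y \<omega>, X' \<omega>')))"
      by (simp add: integral_distr case_prod_beta LIMSEQ_unique)
  qed (auto intro!: finite_measure.finite_measure_distr MM.finite_measure_distr finite_measure_distr)
qed

text \<open>
  The hypothesis \<open>stop\<close> says that \<open>\<nu>\<close> is a stopping time: whether \<open>\<nu> d = p\<close> depends only on the first
  \<open>p\<close> entries of \<open>d\<close>.
\<close>

lemma (in sequence_space) resample_after_stopping:
  assumes \<nu> [measurable]: "\<nu> \<in> measurable S (count_space UNIV)"
    and stop: "\<And>p d d'. \<nu> (comb_seq p d d') = p \<longleftrightarrow> \<nu> d = p"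
  shows "distr (S \<Otimes>\<^sub>M S) S (\<lambda>(d, d'). comb_seq (\<nu> d) d d') = S"
proof (rule measure_eqI)
  have [measurable]: "(\<lambda>(d, d'). comb_seq (\<nu> d) d d') \<in> measurable (S \<Otimes>\<^sub>M S) S"
    unfolding case_prod_beta
    by (rule measurable_compose_countable[where g = "\<lambda>z. \<nu> (fst z)"]) measurable
  fix A assume "A \<in> sets (distr (S \<Otimes>\<^sub>M S) S (\<lambda>(d, d'). comb_seq (\<nu> d) d d'))"
  then have A [measurable]: "A \<in> sets S" by simp
  define D where "D p = {d \<in> space S. \<nu> d = p \<and> d \<in> A}" for p
  have [measurable]: "D p \<in> sets S" for p unfolding D_def by measurable
  have un: "(\<Union>p. D p) = A"
    using sets.sets_into_space[OF A] by (auto simp: D_def)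
  \<comment> \<open>On \<open>R p\<close> the sequence resampled from \<open>p\<close> on has
    stopping index \<open>p\<close>; by \<open>stop\<close> the original one has it too. For a fixed
    index, \<open>PiM_comb_seq\<close> says that replacing the tail preserves the law.\<close>
  define R where "R p = (\<lambda>(d, d'). comb_seq p d d') -` D p \<inter> space (S \<Otimes>\<^sub>M S)" for p
  have [measurable]: "(\<lambda>(d, d'). comb_seq p d d') \<in> measurable (S \<Otimes>\<^sub>M S) S" for p
    by (rule measurable_comb_seq)
  have [measurable]: "R p \<in> sets (S \<Otimes>\<^sub>M S)" for p unfolding R_def by measurable
  have "emeasure (distr (S \<Otimes>\<^sub>M S) S (\<lambda>(d, d'). comb_seq (\<nu> d) d d')) A =
      emeasure (S \<Otimes>\<^sub>M S) ((\<lambda>(d, d'). comb_seq (\<nu> d) d d') -` A \<inter> space (S \<Otimes>\<^sub>M S))"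
    by (rule emeasure_distr) measurable
  also have "(\<lambda>(d, d'). comb_seq (\<nu> d) d d') -` A \<inter> space (S \<Otimes>\<^sub>M S) = (\<Union>p. R p)"
    using sets.sets_into_space[OF A] by (auto simp: R_def D_def stop)
  also have "emeasure (S \<Otimes>\<^sub>M S) \<dots> = (\<Sum>p. emeasure (S \<Otimes>\<^sub>M S) (R p))"
    by (rule suminf_emeasure[symmetric]) (auto simp: disjoint_family_on_def R_def D_def stop)
  also have "\<dots> = (\<Sum>p. emeasure S (D p))"
  proof (rule suminf_cong)
    fix p
    have "emeasure (S \<Otimes>\<^sub>M S) (R p) = emeasure (distr (S \<Otimes>\<^sub>M S) S (\<lambda>(d, d'). comb_seq p d d')) (D p)"
      unfolding R_def by (rule emeasure_distr[symmetric]) measurable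
    then show "emeasure (S \<Otimes>\<^sub>M S) (R p) = emeasure S (D p)"
      by (simp add: PiM_comb_seq)
  qed
  also have "\<dots> = emeasure S A"
    unfolding un[symmetric] by (rule suminf_emeasure) (auto simp: disjoint_family_on_def D_def)
  finally show "emeasure (distr (S \<Otimes>\<^sub>M S) S (\<lambda>(d, d'). comb_seq (\<nu> d) d d')) A = emeasure S A" .
qed simp

lemma sum_lessThan_add: "(\<Sum>i<m + n. f i) = (\<Sum>i<m. f i) + (\<Sum>l<n. f (m + l))"
  for f :: "nat \<Rightarrow> 'a::comm_monoid_add"
  by (induction n) (simp_all add: add.assoc)

section \<open>The strong Markov property at exit times\<close>

context brownian_motion
begin

text \<open>Increments over a grid of mesh \<open>h\<close> are independent and share one Gaussian
  law; since \<open>B 0 = 0\<close>, this is the law of \<open>B h\<close>.\<close>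

lemma increments_law:
  assumes h: "0 < h"
  shows "distr M (\<Pi>\<^sub>M i\<in>UNIV. borel) (\<lambda>\<omega> i. B (real (Suc i) * h) \<omega> - B (real i * h) \<omega>) =
    (\<Pi>\<^sub>M i\<in>(UNIV::nat set). distr M borel (B h))"
proof -
  let ?s = "\<lambda>i. real i * h" and ?X = "\<lambda>i \<omega>. B (real (Suc i) * h) \<omega> - B (real i * h) \<omega>"
  have rv: "random_variable borel (?X i)" for i
    using h by (intro borel_measurable_diff random_variable_B) auto
  have "strict_mono ?s" using h by (auto simp: strict_mono_def)
  from independent_increments[OF _ this] have "indep_vars (\<lambda>_. borel) ?X UNIV" by simp
  then have "distr M (\<Pi>\<^sub>M i\<in>UNIV. borel) (\<lambda>x. \<lambda>i\<in>UNIV. ?X i x) = (\<Pi>\<^sub>M i\<in>UNIV. distr M borel (?X i))"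
    by (subst (asm) indep_vars_iff_distr_eq_PiM) (use rv in auto)
  moreover have "distr M borel (?X i) = distr M borel (B h)" for i
  proof -
    let ?f = "\<lambda>y::'a. ennreal (\<Prod>b\<in>Basis. normal_density 0 (sqrt h) (y \<bullet> b))"
    have D: "distr M borel (\<lambda>\<omega>. B t \<omega> - B s \<omega>) = density lborel ?f" if "0 \<le> s" "t - s = h" for s t
    proof -
      have "distributed M lborel (\<lambda>\<omega>. B t \<omega> - B s \<omega>) ?f"
        using gaussian_increments[of s t] that h by auto
      then have "distr M lborel (\<lambda>\<omega>. B t \<omega> - B s \<omega>) = density lborel ?f"
        by (rule distributed_distr_eq_density)
      then show ?thesis by (simp cong: distr_cong)
    qed
    have "distr M borel (B h) = distr M borel (\<lambda>\<omega>. B h \<omega> - B 0 \<omega>)"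
      by (intro distr_cong) (auto simp: start_origin)
    also have "\<dots> = distr M borel (?X i)"
      using D[of 0 h] D[of "real i * h" "real (Suc i) * h"] h by (simp add: algebra_simps)
    finally show ?thesis by simp
  qed
  ultimately show ?thesis by (simp add: restrict_UNIV)
qed

text \<open>Everything on the left is a function of the increment sequence, and \<open>T\<close> is
  \<open>h\<close> times a stopping index of it. Resampling the increments after that index keeps
  the law of the sequence and turns the later displacements into those of an independent
  copy.\<close>

lemma grid_strong_markov:
  fixes N :: nat and x :: 'a
  assumes h: "0 < h" and C: "C \<in> sets borel"
  defines "T \<equiv> \<lambda>\<omega>. real (grid_index N C (\<lambda>i. x + B (real i * h) \<omega>)) * h"
  shows "distr M borel (\<lambda>\<omega>. (x + B (T \<omega>) \<omega>, \<lambda>q::rat. B (T \<omega> + real (a q) * h) \<omega> - B (T \<omega>) \<omega>)) =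
    distr (M \<Otimes>\<^sub>M M) borel (\<lambda>(\<omega>, \<omega>'). (x + B (T \<omega>) \<omega>, \<lambda>q. B (real (a q) * h) \<omega>'))"
proof -
  define \<Delta> where "\<Delta> \<omega> i = B (real (Suc i) * h) \<omega> - B (real i * h) \<omega>" for \<omega> i
  have rvB [measurable]: "random_variable borel (B (real i * h))" for i
    using h by (intro random_variable_B) auto
  have B_sum: "B (real n * h) \<omega> = (\<Sum>i<n. \<Delta> \<omega> i)" if "\<omega> \<in> space M" for n \<omega>
    using start_origin[OF that] sum_lessThan_telescope[of "\<lambda>i. B (real i * h) \<omega>" n]
    by (simp add: \<Delta>_def)
  define L where "L = distr M borel (B h)"
  have rvh: "random_variable borel (B h)" using h by (intro random_variable_B) auto
  interpret L: prob_space L unfolding L_def by (rule prob_space_distr[OF rvh])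
  interpret sequence_space L by unfold_locales
  have [measurable_cong]: "sets L = sets borel" by (simp add: L_def)
  have sets_S: "sets S = sets (\<Pi>\<^sub>M i\<in>UNIV. (borel :: 'a measure))"
    by (intro sets_PiM_cong) (auto simp: L_def)
  have \<Delta> [measurable]: "\<Delta> \<in> measurable M S"
    unfolding measurable_cong_sets[OF refl sets_S] \<Delta>_def
    by (rule measurable_PiM_single') (auto intro!: borel_measurable_diff rvB simp del: of_nat_Suc)
  have law: "distr M S \<Delta> = S"
  proof -
    have "distr M S \<Delta> = distr M (\<Pi>\<^sub>M i\<in>UNIV. borel) \<Delta>"
      by (rule distr_cong[OF refl sets_S refl])
    then show ?thesis
      using increments_law[OF h] by (simp add: L_def \<Delta>_def[abs_def])
  qed
  define \<nu> where "\<nu> d = grid_index N C (\<lambda>i. x + (\<Sum>l<i. d l))" for d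
  have \<nu>_eq: "\<nu> d = p \<longleftrightarrow> (N \<le> p \<or> x + (\<Sum>l<p. d l) \<in> C) \<and>
      (\<forall>i<p. \<not> (N \<le> i \<or> x + (\<Sum>l<i. d l) \<in> C))" for d p
    unfolding \<nu>_def by (rule grid_index_eq_iff)
  have sum_meas [measurable]: "(\<lambda>d. \<Sum>l<i. d (k + l)) \<in> borel_measurable S" for i k
    by measurable
  have sum_meas0 [measurable]: "(\<lambda>d. \<Sum>l<i. d l) \<in> borel_measurable S" for i
    by measurable
  have \<nu> [measurable]: "\<nu> \<in> measurable S (count_space UNIV)"
    unfolding \<nu>_def[abs_def] by (intro grid_index_measurable C) measurable
  have comb_sum: "(\<Sum>l<i. comb_seq p d d' l) = (\<Sum>l<i. d l)" if "i \<le> p" for i p and d d' :: "nat \<Rightarrow> 'a"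
    using that by (intro sum.cong) (auto simp: comb_seq_less)
  \<comment> \<open>Positions with grid index up to \<open>p\<close> use only the increments with
    index below \<open>p\<close>, exactly those that \<open>comb_seq p\<close> keeps.\<close>
  have stop: "\<nu> (comb_seq p d d') = p \<longleftrightarrow> \<nu> d = p" for p d d'
    unfolding \<nu>_eq by (simp add: comb_sum)
  \<comment> \<open>\<open>G\<close> recovers the stopped position and the later displacements from
    the increments; resampling before applying it makes its second component a function of
    \<open>d'\<close> alone.\<close>
  define G where "G d = (x + (\<Sum>l<\<nu> d. d l), \<lambda>q. \<Sum>l<a q. d (\<nu> d + l))" for d
  have G_comb: "G (comb_seq (\<nu> d) d d') = (x + (\<Sum>l<\<nu> d. d l), \<lambda>q. \<Sum>l<a q. d' l)" for d d'
  proof -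
    have "\<nu> (comb_seq (\<nu> d) d d') = \<nu> d" using stop by blast
    then show ?thesis by (simp add: G_def comb_sum) (simp add: comb_seq_def)
  qed
  have pre [measurable]: "(\<lambda>d. \<Sum>l<\<nu> d. d l) \<in> borel_measurable S"
    by (rule measurable_compose_countable[where g = \<nu>]) measurable
  have post: "(\<lambda>d. \<Sum>l<a q. d (\<nu> d + l)) \<in> borel_measurable S" for q
    by (rule measurable_compose_countable[where g = \<nu> and f = "\<lambda>k d. \<Sum>l<a q. d (k + l)"]) measurable
  have G [measurable]: "G \<in> borel_measurable S"
    unfolding G_def by (intro measurable_Pair_borel post) measurable
  have \<nu>_\<Delta>: "T \<omega> = real (\<nu> (\<Delta> \<omega>)) * h" if "\<omega> \<in> space M" for \<omega>
    by (simp add: T_def \<nu>_def B_sum[OF that])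
  have G_\<Delta>: "(x + B (T \<omega>) \<omega>, \<lambda>q. B (T \<omega> + real (a q) * h) \<omega> - B (T \<omega>) \<omega>) = G (\<Delta> \<omega>)"
    if \<omega>: "\<omega> \<in> space M" for \<omega>
  proof -
    have "B (T \<omega> + real (a q) * h) \<omega> - B (T \<omega>) \<omega> = (\<Sum>l<a q. \<Delta> \<omega> (\<nu> (\<Delta> \<omega>) + l))" for q
    proof -
      have "T \<omega> + real (a q) * h = real (\<nu> (\<Delta> \<omega>) + a q) * h"
        by (simp add: \<nu>_\<Delta>[OF \<omega>] algebra_simps)
      then have "B (T \<omega> + real (a q) * h) \<omega> = (\<Sum>i<\<nu> (\<Delta> \<omega>) + a q. \<Delta> \<omega> i)"
        by (simp only: B_sum[OF \<omega>])
      also have "\<dots> = (\<Sum>i<\<nu> (\<Delta> \<omega>). \<Delta> \<omega> i) + (\<Sum>l<a q. \<Delta> \<omega> (\<nu> (\<Delta> \<omega>) + l))"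
        by (rule sum_lessThan_add)
      finally show ?thesis by (simp add: \<nu>_\<Delta>[OF \<omega>] B_sum[OF \<omega>])
    qed
    then show ?thesis by (simp add: G_def \<nu>_\<Delta>[OF \<omega>] B_sum[OF \<omega>])
  qed
  have res [measurable]: "(\<lambda>(d, d'). comb_seq (\<nu> d) d d') \<in> measurable (S \<Otimes>\<^sub>M S) S"
    unfolding case_prod_beta
    by (rule measurable_compose_countable[where g = "\<lambda>z. \<nu> (fst z)"]) measurable
  have "sigma_finite_measure (distr M S \<Delta>)"
    unfolding law by unfold_locales
  then have SS: "S \<Otimes>\<^sub>M S = distr (M \<Otimes>\<^sub>M M) (S \<Otimes>\<^sub>M S) (\<lambda>(\<omega>, \<omega>'). (\<Delta> \<omega>, \<Delta> \<omega>'))"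
    using pair_measure_distr[OF \<Delta> \<Delta>] by (simp add: law)
  have "distr M borel (\<lambda>\<omega>. (x + B (T \<omega>) \<omega>, \<lambda>q. B (T \<omega> + real (a q) * h) \<omega> - B (T \<omega>) \<omega>)) =
      distr M borel (G \<circ> \<Delta>)"
    by (intro distr_cong) (auto simp: G_\<Delta>)
  also have "\<dots> = distr (distr M S \<Delta>) borel G" by (rule distr_distr[symmetric]) measurable
  also have "\<dots> = distr (distr (S \<Otimes>\<^sub>M S) S (\<lambda>(d, d'). comb_seq (\<nu> d) d d')) borel G"
    unfolding law resample_after_stopping[OF \<nu> stop] ..
  also have "\<dots> = distr (S \<Otimes>\<^sub>M S) borel (G \<circ> (\<lambda>(d, d'). comb_seq (\<nu> d) d d'))"
    by (rule distr_distr) measurable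
  also have "\<dots> = distr (M \<Otimes>\<^sub>M M) borel ((G \<circ> (\<lambda>(d, d'). comb_seq (\<nu> d) d d')) \<circ> (\<lambda>(\<omega>, \<omega>'). (\<Delta> \<omega>, \<Delta> \<omega>')))"
    by (subst SS, rule distr_distr) measurable
  also have "\<dots> = distr (M \<Otimes>\<^sub>M M) borel (\<lambda>(\<omega>, \<omega>'). (x + B (T \<omega>) \<omega>, \<lambda>q. B (real (a q) * h) \<omega>'))"
    by (intro distr_cong) (auto simp: space_pair_measure G_comb \<nu>_\<Delta> B_sum)
  finally show ?thesis .
qed

definition hit_prob :: "'a set \<Rightarrow> 'a set \<Rightarrow> 'a \<Rightarrow> real" where
  "hit_prob F V x = prob {\<omega> \<in> space M. hits F V (\<lambda>t. x + B t \<omega>)}"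

definition exits :: "'a set \<Rightarrow> 'a \<Rightarrow> 'w \<Rightarrow> bool" where
  "exits W x \<omega> \<longleftrightarrow> (\<exists>t\<ge>0. x + B t \<omega> \<in> - W)"

text \<open>
  On paths that stay in \<open>W\<close>, \<^const>\<open>exit_time\<close> is an unspecified and possibly negative number, and
  nothing is known about \<open>B\<close> at negative times.
\<close>

definition exit_time\<^sub>0 :: "'a set \<Rightarrow> 'a \<Rightarrow> 'w \<Rightarrow> real" where
  "exit_time\<^sub>0 W x \<omega> = (if exits W x \<omega> then exit_time B W x \<omega> else 0)"

lemma exit_time_eq_hit_time: "exit_time B W x \<omega> = hit_time (- W) (\<lambda>t. x + B t \<omega>)"
  by (simp add: exit_time_def hit_time_def)

lemma continuous_path:
  "\<omega> \<in> space M \<Longrightarrow> continuous_on {0..} (\<lambda>t. x + B t \<omega>)"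
  by (intro continuous_intros continuous_paths)

lemma hits_iff_hits_rat:
  assumes "\<omega> \<in> space M" "closed F" "open V"
  shows "hits F V (\<lambda>t. x + B t \<omega>) \<longleftrightarrow> hits_rat F V (\<lambda>q. x + B \<bar>real_of_rat q\<bar> \<omega>)"
  using hits_rat_iff[OF continuous_path[OF assms(1)] assms(2,3)] by simp

lemma hits_event [measurable]:
  assumes "closed F" "open V"
  shows "{\<omega> \<in> space M. hits F V (\<lambda>t. x + B t \<omega>)} \<in> events"
proof -
  have "{\<omega> \<in> space M. hits F V (\<lambda>t. x + B t \<omega>)} =
      {\<omega> \<in> space M. hits_rat F V (\<lambda>q. x + B \<bar>real_of_rat q\<bar> \<omega>)}"
    using hits_iff_hits_rat assms by blast
  also have "\<dots> \<in> events"
    by (intro hits_rat_measurable borel_measurable_add borel_measurable_const random_variable_B) simp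
  finally show ?thesis .
qed

lemma exits_iff_hits: "exits W x \<omega> \<longleftrightarrow> hits (- W) UNIV (\<lambda>t. x + B t \<omega>)"
  by (simp add: exits_def hits_def)

lemma exits_event [measurable]: "open W \<Longrightarrow> {\<omega> \<in> space M. exits W x \<omega>} \<in> events"
  unfolding exits_iff_hits by (intro hits_event) auto

section \<open>Evaluation at random times and limits of the strong Markov property\<close>

text \<open>Rounding \<open>T\<close> up to the dyadic grid leaves countably many values, for which
  measurability is clear; continuity of paths gives the limit.\<close>

lemma random_variable_at:
  assumes T [measurable]: "T \<in> borel_measurable M" and T_nonneg: "\<And>\<omega>. \<omega> \<in> space M \<Longrightarrow> 0 \<le> T \<omega>"
  shows "(\<lambda>\<omega>. B (T \<omega>) \<omega>) \<in> borel_measurable M"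
proof (rule borel_measurable_LIMSEQ_metric)
  fix k :: nat
  have [measurable]: "(\<lambda>\<omega>. nat \<lceil>T \<omega> * 2^k\<rceil>) \<in> measurable M (count_space UNIV)" by measurable
  have [measurable]: "random_variable borel (B (real i / 2^k))" for i
    by (intro random_variable_B) simp
  show "(\<lambda>\<omega>. B (real (nat \<lceil>T \<omega> * 2^k\<rceil>) / 2^k) \<omega>) \<in> borel_measurable M"
    by (rule measurable_compose_countable[where g = "\<lambda>\<omega>. nat \<lceil>T \<omega> * 2^k\<rceil>" and
      f = "\<lambda>i \<omega>. B (real i / 2^k) \<omega>"]) measurable
next
  fix \<omega> assume \<omega>: "\<omega> \<in> space M"
  show "(\<lambda>k. B (real (nat \<lceil>T \<omega> * 2^k\<rceil>) / 2^k) \<omega>) \<longlonglongrightarrow> B (T \<omega>) \<omega>"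
    by (intro continuous_on_tendsto_compose[OF continuous_paths[OF \<omega>]] dyadic_tendsto
        always_eventually allI T_nonneg[OF \<omega>]) (simp_all only: atLeast_iff T_nonneg[OF \<omega>], simp)
qed

text \<open>Just what makes \<open>B (T \<omega>) \<omega>\<close> measurable. Independence of the
  future enters through \<open>grid_index\<close> and is transported by
  \<open>strong_markov\<close>.\<close>

definition random_time :: "('w \<Rightarrow> real) \<Rightarrow> bool" where
  "random_time T \<longleftrightarrow> T \<in> borel_measurable M \<and> (\<forall>\<omega>\<in>space M. 0 \<le> T \<omega>)"

text \<open>
  The path restarted at time \<open>T\<close> and sampled at the times \<open>a q\<close> is, jointly with its starting point,
  distributed like the path of a second, independent copy of the process.
\<close>

definition strong_markov :: "'a \<Rightarrow> ('w \<Rightarrow> real) \<Rightarrow> (rat \<Rightarrow> real) \<Rightarrow> bool" where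
  "strong_markov x T a \<longleftrightarrow>
    distr M borel (\<lambda>\<omega>. (x + B (T \<omega>) \<omega>, \<lambda>q. B (T \<omega> + a q) \<omega> - B (T \<omega>) \<omega>)) =
    distr (M \<Otimes>\<^sub>M M) borel (\<lambda>(\<omega>, \<omega>'). (x + B (T \<omega>) \<omega>, \<lambda>q. B (a q) \<omega>'))"

lemma random_time_const: "0 \<le> c \<Longrightarrow> random_time (\<lambda>_. c)"
  by (simp add: random_time_def)

lemma random_time_add: "random_time T \<Longrightarrow> 0 \<le> c \<Longrightarrow> random_time (\<lambda>\<omega>. T \<omega> + c)"
  by (auto simp: random_time_def)

lemma measurable_random_time [measurable]: "random_time T \<Longrightarrow> (\<lambda>\<omega>. B (T \<omega>) \<omega>) \<in> borel_measurable M"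
  by (intro random_variable_at) (auto simp: random_time_def)

lemma measurable_post:
  "random_time T \<Longrightarrow> 0 \<le> c \<Longrightarrow> (\<lambda>\<omega>. B (T \<omega> + c) \<omega> - B (T \<omega>) \<omega>) \<in> borel_measurable M"
  using measurable_random_time[OF random_time_add, of T c]
  by (intro borel_measurable_diff) auto

lemma strong_markov_limit:
  assumes T: "\<And>k. random_time (T\<^sub>n k)" "random_time T" and a: "\<And>k q. 0 \<le> a\<^sub>n k q" "\<And>q. 0 \<le> a q"
    and lim: "AE \<omega> in M. (\<lambda>k. T\<^sub>n k \<omega>) \<longlonglongrightarrow> T \<omega>" "\<And>q. (\<lambda>k. a\<^sub>n k q) \<longlonglongrightarrow> a q"
    and sm: "\<And>k. strong_markov x (T\<^sub>n k) (a\<^sub>n k)"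
  shows "strong_markov x T a"
proof -
  have B_lim: "(\<lambda>k. B (t k) \<omega>) \<longlonglongrightarrow> B t' \<omega>"
    if "\<omega> \<in> space M" "t \<longlonglongrightarrow> t'" "\<And>k. 0 \<le> t k" "0 \<le> t'" for \<omega> t t'
    using that by (intro continuous_on_tendsto_compose[OF continuous_paths]) auto
  have nn: "0 \<le> T\<^sub>n k \<omega>" "0 \<le> T \<omega>" if "\<omega> \<in> space M" for k \<omega>
    using T that by (auto simp: random_time_def)
  show ?thesis
    unfolding strong_markov_def
  proof (rule joint_law_limit)
    show "AE \<omega> in M. (\<lambda>k. x + B (T\<^sub>n k \<omega>) \<omega>) \<longlonglongrightarrow> x + B (T \<omega>) \<omega>"
      using lim(1) AE_space by eventually_elim (intro tendsto_intros B_lim nn)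
    show "AE \<omega> in M. \<forall>q. (\<lambda>k. B (T\<^sub>n k \<omega> + a\<^sub>n k q) \<omega> - B (T\<^sub>n k \<omega>) \<omega>) \<longlonglongrightarrow> B (T \<omega> + a q) \<omega> - B (T \<omega>) \<omega>"
      using lim(1) AE_space by eventually_elim (intro allI tendsto_intros B_lim nn add_nonneg_nonneg a lim(2))
    show "AE \<omega> in M. \<forall>q. (\<lambda>k. B (a\<^sub>n k q) \<omega>) \<longlonglongrightarrow> B (a q) \<omega>"
      using AE_space by eventually_elim (intro allI B_lim a lim(2))
  qed (use sm T a in \<open>auto simp: strong_markov_def intro!: measurable_post random_time_const
      borel_measurable_add measurable_random_time\<close>)
qed

text \<open>Two limits are taken: \<open>G j k\<close> tends to \<open>\<tau> j\<close> as the grid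
  is refined, and \<open>\<tau> j\<close> to the exit time as the neighbourhood shrinks. The first
  convergence is known only on the event \<open>E\<close> of leaving \<open>W\<close>, hence the
  almost sure exit in the second claim.\<close>

lemma strong_markov_exit:
  assumes W: "open W"
  shows random_time_exit: "random_time (exit_time\<^sub>0 W x)"
    and "(AE \<omega> in M. exits W x \<omega>) \<Longrightarrow> strong_markov x (exit_time\<^sub>0 W x) (\<lambda>q. \<bar>real_of_rat q\<bar>)"
proof -
  define P where "P \<omega> t = x + B t \<omega>" for \<omega> t
  define E where "E = {\<omega> \<in> space M. exits W x \<omega>}"
  have E [measurable]: "E \<in> events" unfolding E_def using W by measurable
  have E_ex: "\<exists>t\<ge>0. P \<omega> t \<in> nbhd j (- W)" "\<exists>t\<ge>0. P \<omega> t \<in> - W" if "\<omega> \<in> E" for \<omega> j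
    using that subset_nbhd[of "- W" j] by (auto simp: E_def exits_def P_def)
  have P_cont: "continuous_on {0..} (P \<omega>)" if "\<omega> \<in> space M" for \<omega>
    unfolding P_def using that by (rule continuous_path)
  define G where "G j k \<omega> = real (grid_index (k * 2^k) (nbhd j (- W)) (\<lambda>i. P \<omega> (i / 2^k))) / 2^k" for j k \<omega>
  have rvP: "(\<lambda>\<omega>. P \<omega> (real i / 2^k)) \<in> borel_measurable M" for i k
    unfolding P_def by (intro borel_measurable_add borel_measurable_const random_variable_B) simp
  have G_meas [measurable]: "G j k \<in> borel_measurable M" for j k
  proof -
    have [measurable]: "(\<lambda>\<omega>. grid_index (k * 2^k) (nbhd j (- W)) (\<lambda>i. P \<omega> (i / 2^k))) \<in>
        measurable M (count_space UNIV)"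
      by (intro grid_index_measurable rvP borel_open open_nbhd)
    show ?thesis unfolding G_def by measurable
  qed
  have G_rt: "random_time (G j k)" for j k
    using G_meas by (auto simp: random_time_def G_def)
  \<comment> \<open>The indicator matches the default value 0 of \<open>exit_time\<^sub>0\<close> on
    paths that stay in \<open>W\<close>, so the limit in \<open>j\<close> holds on all of
    \<open>space M\<close> and gives measurability.\<close>
  define \<tau> where "\<tau> j \<omega> = indicator E \<omega> * hit_time (nbhd j (- W)) (P \<omega>)" for j \<omega>
  have G_lim: "(\<lambda>k. G j k \<omega>) \<longlonglongrightarrow> hit_time (nbhd j (- W)) (P \<omega>)" if "\<omega> \<in> E" for j \<omega>
    unfolding G_def using that
    by (intro hit_time_grid_tendsto P_cont open_nbhd E_ex) (auto simp: E_def)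
  have [measurable]: "\<tau> j \<in> borel_measurable M" for j
  proof (rule borel_measurable_LIMSEQ_real)
    show "(\<lambda>k. indicator E \<omega> * G j k \<omega>) \<longlonglongrightarrow> \<tau> j \<omega>" for \<omega>
      using G_lim by (cases "\<omega> \<in> E") (auto simp: \<tau>_def)
  qed measurable
  have \<tau>_rt: "random_time (\<tau> j)" for j
    using hit_time_nonneg[OF E_ex(1)] by (auto simp: random_time_def \<tau>_def indicator_def)
  let ?T = "exit_time\<^sub>0 W x"
  have T_E: "?T \<omega> = hit_time (- W) (P \<omega>)" if "\<omega> \<in> E" for \<omega>
    using that by (simp add: exit_time\<^sub>0_def E_def exit_time_eq_hit_time P_def[abs_def])
  have \<tau>_lim: "(\<lambda>j. \<tau> j \<omega>) \<longlonglongrightarrow> ?T \<omega>" if "\<omega> \<in> space M" for \<omega>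
  proof (cases "\<omega> \<in> E")
    case True
    then have "(\<lambda>j. hit_time (nbhd j (- W)) (P \<omega>)) \<longlonglongrightarrow> hit_time (- W) (P \<omega>)"
      using W that by (intro hit_time_nbhd_tendsto P_cont E_ex) auto
    with True T_E[OF True] show ?thesis by (simp add: \<tau>_def)
  next
    case False
    with that show ?thesis by (simp add: \<tau>_def exit_time\<^sub>0_def E_def)
  qed
  have "?T \<in> borel_measurable M"
    using \<tau>_lim by (rule borel_measurable_LIMSEQ_real) measurable
  then show T_rt: "random_time ?T"
    using hit_time_nonneg[OF E_ex(2)] T_E by (auto simp: random_time_def exit_time\<^sub>0_def E_def)
  assume ex: "AE \<omega> in M. exits W x \<omega>"
  have AE_E: "AE \<omega> in M. \<omega> \<in> E" using ex AE_space by eventually_elim (simp add: E_def)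
  have "strong_markov x (\<tau> j) (\<lambda>q. \<bar>real_of_rat q\<bar>)" for j
  \<comment> \<open>The sampling times are rounded up to the grid as well, since the discrete result
    only sees multiples of the mesh.\<close>
  proof (rule strong_markov_limit[where T\<^sub>n = "G j" and a\<^sub>n = "\<lambda>k q. real (nat \<lceil>\<bar>real_of_rat q\<bar> * 2^k\<rceil>) / 2^k"])
    show "AE \<omega> in M. (\<lambda>k. G j k \<omega>) \<longlonglongrightarrow> \<tau> j \<omega>"
      using AE_E by eventually_elim (simp add: \<tau>_def G_lim)
    show "strong_markov x (G j k) (\<lambda>q. real (nat \<lceil>\<bar>real_of_rat q\<bar> * 2^k\<rceil>) / 2^k)" for k
      using grid_strong_markov[where h = "1 / 2^k" and C = "nbhd j (- W)" and N = "k * 2^k" and x = x and a = "\<lambda>q. nat \<lceil>\<bar>real_of_rat q\<bar> * 2^k\<rceil>"]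
      by (simp add: strong_markov_def G_def P_def open_nbhd)
    show "0 \<le> real (nat \<lceil>\<bar>real_of_rat q\<bar> * 2^k\<rceil>) / 2^k" for k q
      by (intro divide_nonneg_nonneg of_nat_0_le_iff) simp
    show "(\<lambda>k. real (nat \<lceil>\<bar>real_of_rat q\<bar> * 2^k\<rceil>) / 2^k) \<longlonglongrightarrow> \<bar>real_of_rat q\<bar>" for q
      by (rule dyadic_tendsto) simp
  qed (simp_all only: G_rt \<tau>_rt abs_ge_zero)
  then show "strong_markov x ?T (\<lambda>q. \<bar>real_of_rat q\<bar>)"
    using \<tau>_lim by (intro strong_markov_limit[where T\<^sub>n = \<tau> and a\<^sub>n = "\<lambda>_ q. \<bar>real_of_rat q\<bar>", OF \<tau>_rt T_rt]) auto
qed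

section \<open>Harmonic measure and hitting probabilities\<close>

text \<open>The Gaussian density at time \<open>t\<close> is a product of factors at most
  \<open>1 / sqrt t\<close>; for \<open>1 \<le> t\<close> a single factor already bounds it in every
  dimension.\<close>

lemma prob_in_bounded:
  fixes S :: "'a set"
  assumes S: "S \<in> sets borel" "emeasure lborel S < \<infinity>" and t: "1 \<le> t"
  shows "prob {\<omega> \<in> space M. B t \<omega> \<in> S} \<le> measure lborel S / sqrt t"
proof -
  let ?f = "\<lambda>y::'a. \<Prod>b\<in>Basis. normal_density 0 (sqrt t) (y \<bullet> b)"
  have dens: "distributed M lborel (\<lambda>\<omega>. B t \<omega> - B 0 \<omega>) (\<lambda>y. ennreal (?f y))"
    using gaussian_increments[of 0 t] t by simp
  have bound: "?f y \<le> 1 / sqrt t" for y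
  proof -
    have one: "normal_density 0 (sqrt t) z \<le> 1 / sqrt t" for z
    proof -
      have "normal_density 0 (sqrt t) z \<le> 1 / sqrt (2 * pi * t)"
        using t by (auto simp: normal_density_def divide_simps mult_left_le)
      also have "\<dots> \<le> 1 / sqrt t"
      proof (intro divide_left_mono real_sqrt_le_mono)
        have "1 * t \<le> (2 * pi) * t" using t pi_ge_two by (intro mult_right_mono) auto
        then show "t \<le> 2 * pi * t" by simp
      qed (use t in auto)
      finally show ?thesis .
    qed
    have "?f y \<le> (\<Prod>b\<in>(Basis::'a set). 1 / sqrt t)"
      by (intro prod_mono conjI one) auto
    also have "\<dots> = (1 / sqrt t) ^ DIM('a)" by simp
    also have "\<dots> \<le> (1 / sqrt t) ^ 1"
      using t by (intro power_decreasing) (auto simp: Suc_le_eq)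
    finally show ?thesis by simp
  qed
  have "emeasure M {\<omega> \<in> space M. B t \<omega> \<in> S} = emeasure M ((\<lambda>\<omega>. B t \<omega> - B 0 \<omega>) -` S \<inter> space M)"
    by (intro arg_cong[where f = "emeasure M"]) (auto simp: start_origin)
  also have "\<dots> = (\<integral>\<^sup>+y. ennreal (?f y) * indicator S y \<partial>lborel)"
    using S(1) by (intro distributed_emeasure[OF dens]) simp
  also have "\<dots> \<le> (\<integral>\<^sup>+y. ennreal (1 / sqrt t) * indicator S y \<partial>lborel)"
    by (intro nn_integral_mono mult_right_mono ennreal_leI bound) auto
  also have "\<dots> = ennreal (1 / sqrt t) * emeasure lborel S"
    using S(1) by (intro nn_integral_cmult_indicator) simp
  also have "\<dots> = ennreal (measure lborel S / sqrt t)"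
    using S(2) t by (simp add: emeasure_eq_ennreal_measure ennreal_mult[symmetric])
  finally show ?thesis
    using t by (simp add: emeasure_eq_measure)
qed

text \<open>A path that never leaves \<open>W\<close> is in a fixed ball at every time
  \<open>n\<close>, an event whose probability is at most a constant over
  \<open>sqrt n\<close>.\<close>

lemma AE_exits_bounded:
  assumes W: "open W" "bounded W"
  shows "AE \<omega> in M. exits W x \<omega>"
proof -
  obtain R where R: "\<And>w. w \<in> W \<Longrightarrow> norm w \<le> R" using W(2) by (auto simp: bounded_iff)
  let ?S = "cball (- x) R"
  define N where "N = {\<omega> \<in> space M. \<not> exits W x \<omega>}"
  have [measurable]: "N \<in> events" unfolding N_def using W(1) by measurable
  have le: "prob N \<le> measure lborel ?S / sqrt (real n)" if "1 \<le> n" for n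
  proof -
    have "B (real n) \<omega> \<in> ?S" if "\<omega> \<in> N" for \<omega>
    proof -
      have "x + B (real n) \<omega> \<in> W" using that by (auto simp: N_def exits_def)
      then have "norm (x + B (real n) \<omega>) \<le> R" by (rule R)
      moreover have "dist (- x) (B (real n) \<omega>) = norm (x + B (real n) \<omega>)"
        by (metis dist_norm dist_commute add.commute diff_minus_eq_add)
      ultimately show ?thesis by simp
    qed
    then have "prob N \<le> prob {\<omega> \<in> space M. B (real n) \<omega> \<in> ?S}"
    proof (intro finite_measure_mono)
      have [measurable]: "random_variable borel (B (real n))" by (intro random_variable_B) simp
      have "?S \<in> sets borel" by simp
      from measurable_sets[OF _ this] show "{\<omega> \<in> space M. B (real n) \<omega> \<in> ?S} \<in> events"
        by (simp add: vimage_def Int_def conj_commute)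
    qed (auto simp: N_def)
    also have "\<dots> \<le> measure lborel ?S / sqrt (real n)"
      using that emeasure_bounded_finite[OF bounded_cball, of "- x" R] by (intro prob_in_bounded) auto
    finally show ?thesis .
  qed
  have "(\<lambda>n. measure lborel ?S / sqrt (real n)) \<longlonglongrightarrow> 0"
    by (intro tendsto_divide_0[OF tendsto_const] filterlim_at_top_imp_at_infinity
      filterlim_compose[OF sqrt_at_top filterlim_real_sequentially])
  then have "prob N \<le> 0"
    by (rule LIMSEQ_le_const) (use le in blast)
  then have "prob N = 0" by (simp add: measure_le_0_iff)
  then have "N \<in> null_sets M" by (auto simp: emeasure_eq_measure)
  then show ?thesis by (rule AE_I') (auto simp: N_def)
qed

definition exit_point :: "'a set \<Rightarrow> 'a \<Rightarrow> 'w \<Rightarrow> 'a" where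
  "exit_point W x \<omega> = x + B (exit_time\<^sub>0 W x \<omega>) \<omega>"

lemma exit_point_measurable [measurable]: "open W \<Longrightarrow> exit_point W x \<in> borel_measurable M"
  unfolding exit_point_def
  by (intro borel_measurable_add borel_measurable_const measurable_random_time random_time_exit)

lemma exit_point_props:
  assumes W: "open W" and \<omega>: "\<omega> \<in> space M" "exits W x \<omega>"
  shows "exit_point W x \<omega> \<notin> W" "0 \<le> exit_time\<^sub>0 W x \<omega>"
    and "\<And>s. 0 \<le> s \<Longrightarrow> s < exit_time\<^sub>0 W x \<omega> \<Longrightarrow> x + B s \<omega> \<in> W"
    and "x \<in> W \<Longrightarrow> exit_point W x \<omega> \<in> closure W"
proof -
  let ?p = "\<lambda>t. x + B t \<omega>" and ?T = "exit_time\<^sub>0 W x \<omega>"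
  have ex: "\<exists>t\<ge>0. ?p t \<in> - W" using \<omega>(2) by (simp add: exits_def)
  have T: "?T = hit_time (- W) ?p"
    using \<omega>(2) by (simp add: exit_time\<^sub>0_def exit_time_eq_hit_time)
  show nn: "0 \<le> ?T" unfolding T by (rule hit_time_nonneg[OF ex])
  have "?p ?T \<in> closure (- W)"
    unfolding T by (rule hit_time_in_closure[OF continuous_path[OF \<omega>(1)] ex])
  then show notin: "exit_point W x \<omega> \<notin> W" using closure_closed[OF closed_Compl[OF W]] by (simp add: exit_point_def del: closure_complement)
  show before: "?p s \<in> W" if "0 \<le> s" "s < ?T" for s
    using not_before_hit_time[of s "- W" ?p] that by (simp add: T)
  assume "x \<in> W"
  \<comment> \<open>Starting inside \<open>W\<close> forces a positive exit time, so the exit point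
    can be approached from the left along positions in \<open>W\<close>.\<close>
  with notin have "?T \<noteq> 0" using start_origin[OF \<omega>(1)] by (auto simp: exit_point_def)
  with nn have "0 < ?T" by simp
  then obtain q where q: "\<And>n. 0 \<le> real_of_rat (q n)" "\<And>n. real_of_rat (q n) < ?T"
    "(\<lambda>n. real_of_rat (q n)) \<longlonglongrightarrow> ?T" using rat_seq_below by blast
  have "(\<lambda>n. ?p (real_of_rat (q n))) \<longlonglongrightarrow> ?p ?T"
    using q nn by (intro continuous_on_tendsto_compose[OF continuous_path[OF \<omega>(1)]]) auto
  moreover have "\<forall>n. ?p (real_of_rat (q n)) \<in> W" using before q by blast
  ultimately show "exit_point W x \<omega> \<in> closure W"
    unfolding closure_sequential exit_point_def by (intro exI[of _ "\<lambda>n. ?p (real_of_rat (q n))"] conjI)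
qed

section \<open>Exit distributions as hitting probabilities\<close>

lemma emeasure_harmonic_measure:
  assumes W: "open W" and C: "C \<in> sets borel"
  shows "emeasure (harmonic_measure M B W x) C =
    emeasure M {\<omega> \<in> space M. exits W x \<omega> \<and> exit_point W x \<omega> \<in> C}"
proof -
  define E where "E = {\<omega> \<in> space M. exits W x \<omega>}"
  note [measurable] = exits_event[OF W] exit_point_measurable[OF W] C
  have E: "E \<in> events" unfolding E_def by measurable
  have eq: "x + B (exit_time B W x \<omega>) \<omega> = exit_point W x \<omega>" if "\<omega> \<in> E" for \<omega>
    using that by (simp add: E_def exit_point_def exit_time\<^sub>0_def)
  have sp: "space (restrict_space M E) = E" using E sets.sets_into_space by (auto simp: space_restrict_space)
  have meas: "(\<lambda>\<omega>. x + B (exit_time B W x \<omega>) \<omega>) \<in> borel_measurable (restrict_space M E)"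
    by (subst measurable_cong[where g = "exit_point W x"]) (auto simp: sp eq intro!: measurable_restrict_space1)
  have "{\<omega> \<in> space M. \<exists>t\<ge>0. x + B t \<omega> \<notin> W} = E" by (simp add: E_def exits_def)
  then have "emeasure (harmonic_measure M B W x) C =
      emeasure (restrict_space M E) ((\<lambda>\<omega>. x + B (exit_time B W x \<omega>) \<omega>) -` C \<inter> E)"
    unfolding harmonic_measure_def using emeasure_distr[OF meas C] by (simp add: sp)
  also have "\<dots> = emeasure M ((\<lambda>\<omega>. x + B (exit_time B W x \<omega>) \<omega>) -` C \<inter> E)"
    using E by (intro emeasure_restrict_space) auto
  also have "(\<lambda>\<omega>. x + B (exit_time B W x \<omega>) \<omega>) -` C \<inter> E =
      {\<omega> \<in> space M. exits W x \<omega> \<and> exit_point W x \<omega> \<in> C}"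
    using eq by (auto simp: E_def)
  finally show ?thesis .
qed

text \<open>Leaving \<open>V - F\<close> at a point of \<open>V\<close> means leaving it into
  \<open>F\<close>, with the whole path so far in \<open>V\<close>. Conversely, a hit at time
  \<open>t\<close> bounds the exit time by \<open>t\<close>, so the exit point is still in
  \<open>V\<close>.\<close>

lemma exit_in_iff_hits:
  assumes V: "open V" and F: "closed F" and x: "x \<in> V - F" and \<omega>: "\<omega> \<in> space M"
  shows "exits (V - F) x \<omega> \<and> exit_point (V - F) x \<omega> \<in> V \<inter> F \<longleftrightarrow> hits F V (\<lambda>t. x + B t \<omega>)"
proof -
  have W: "open (V - F)" using V F by auto
  let ?T = "exit_time\<^sub>0 (V - F) x \<omega>"
  show ?thesis
  proof safe
    assume ex: "exits (V - F) x \<omega>" and pt: "exit_point (V - F) x \<omega> \<in> F" "exit_point (V - F) x \<omega> \<in> V"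
    have "x + B s \<omega> \<in> V" if "s \<in> {0..?T}" for s
      using exit_point_props(3)[OF W \<omega> ex, of s] pt(2) that
      by (cases "s = ?T") (auto simp: exit_point_def)
    with pt exit_point_props(2)[OF W \<omega> ex] show "hits F V (\<lambda>t. x + B t \<omega>)"
      unfolding hits_def exit_point_def by blast
  next
    assume "hits F V (\<lambda>t. x + B t \<omega>)"
    then obtain t where t: "0 \<le> t" "x + B t \<omega> \<in> F" "\<And>s. s \<in> {0..t} \<Longrightarrow> x + B s \<omega> \<in> V"
      by (auto simp: hits_def)
    show ex: "exits (V - F) x \<omega>" using t by (auto simp: exits_def)
    have "?T \<le> t"
      using t ex unfolding exit_time\<^sub>0_def exit_time_eq_hit_time by (auto intro!: hit_time_le)
    then show inV: "exit_point (V - F) x \<omega> \<in> V"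
      using t(3) exit_point_props(2)[OF W \<omega> ex] by (simp add: exit_point_def)
    with exit_point_props(1)[OF W \<omega> ex] show "exit_point (V - F) x \<omega> \<in> F" by blast
  qed
qed

lemma harmonic_measure_eq_hit_prob:
  assumes V: "open V" and F: "closed F" and x: "x \<in> V - F"
  shows "emeasure (harmonic_measure M B (V - F) x) (V \<inter> F) = hit_prob F V x"
proof -
  have "open (V - F)" "V \<inter> F \<in> sets borel" using V F by auto
  then show ?thesis
    unfolding hit_prob_def emeasure_eq_measure[symmetric]
    using exit_in_iff_hits[OF V F x] by (subst emeasure_harmonic_measure) (auto intro!: arg_cong[where f = "emeasure M"])
qed

lemma hit_prob_self: "closed F \<Longrightarrow> open V \<Longrightarrow> x \<in> V \<inter> F \<Longrightarrow> hit_prob F V x = 1"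
proof -
  assume "x \<in> V \<inter> F"
  then have "hits F V (\<lambda>t. x + B t \<omega>)" if "\<omega> \<in> space M" for \<omega>
    using start_origin[OF that] unfolding hits_def by (intro exI[of _ 0]) auto
  then have "{\<omega> \<in> space M. hits F V (\<lambda>t. x + B t \<omega>)} = space M" by blast
  then show ?thesis by (simp add: hit_prob_def prob_space)
qed

text \<open>The form \<open>V \<inter> F\<close> with \<open>F\<close> closed in the whole space
  covers both the closed sets \<open>E\<close> inside \<open>V (Suc n)\<close> and the relatively
  closed set \<open>A\<close> in \<open>U\<close>.\<close>

lemma dirichlet_solution_eq_hit_prob:
  assumes V: "open V" and F: "closed F" and x: "x \<in> V"
  shows "dirichlet_solution M B (V - V \<inter> F) (indicator (V \<inter> F)) x = hit_prob F V x"
proof (cases "x \<in> F")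
  case True
  then show ?thesis using assms hit_prob_self by (simp add: dirichlet_solution_def)
next
  case False
  have [simp]: "V - V \<inter> F = V - F" by blast
  have sp: "space (harmonic_measure M B (V - F) x) = UNIV" by (simp add: harmonic_measure_def)
  have "measure (harmonic_measure M B (V - F) x) (V \<inter> F) = hit_prob F V x"
    using harmonic_measure_eq_hit_prob[OF V F] x False
    by (simp add: measure_def hit_prob_def)
  with x False show ?thesis by (simp add: dirichlet_solution_def sp)
qed

lemma hit_prob_mono: "closed F \<Longrightarrow> open V \<Longrightarrow> open V' \<Longrightarrow> V \<subseteq> V' \<Longrightarrow> hit_prob F V x \<le> hit_prob F V' x"
  unfolding hit_prob_def by (intro finite_measure_mono hits_event) (auto simp: hits_def)

lemma prob_not_hits:
  "closed F \<Longrightarrow> open V \<Longrightarrow> prob {\<omega> \<in> space M. \<not> hits F V (\<lambda>t. x + B t \<omega>)} = 1 - hit_prob F V x"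
  unfolding hit_prob_def by (subst prob_neg) auto

text \<open>A path that misses \<open>F\<close> also misses it after leaving \<open>W\<close>. By
  the strong Markov property the restarted path is an independent one from the exit point
  \<open>y\<close>, and misses \<open>F\<close> with probability at most \<open>c\<close> if
  \<open>y\<close> is in \<open>C\<close>; integration over the exit point gives the
  product.\<close>

lemma exit_bound:
  assumes W: "open W" "bounded W" "W \<subseteq> V" and F: "closed F" and V: "open V"
    and C: "C \<in> sets borel" and c: "0 \<le> c" and le: "\<And>y. y \<in> C \<Longrightarrow> 1 - hit_prob F V y \<le> c"
  shows "prob {\<omega> \<in> space M. exit_point W x \<omega> \<in> C \<and> \<not> hits F V (\<lambda>t. x + B t \<omega>)} \<le>
    c * prob {\<omega> \<in> space M. exit_point W x \<omega> \<in> C}"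
proof -
  let ?T = "exit_time\<^sub>0 W x" and ?Y = "exit_point W x"
  have AE: "AE \<omega> in M. exits W x \<omega>" by (rule AE_exits_bounded[OF W(1,2)])
  have rt: "random_time ?T" by (rule random_time_exit[OF W(1)])
  note [measurable] = exit_point_measurable[OF W(1)] C hits_event[OF F V]
  interpret MM: pair_prob_space M M ..
  \<comment> \<open>The bad event as a Borel set of pairs (starting point, sampled displacements),
    to which the identity of joint laws applies.\<close>
  define D where "D = {z::'a \<times> (rat \<Rightarrow> 'a). fst z \<in> C \<and> \<not> hits_rat F V (\<lambda>q. fst z + snd z q)}"
  have D [measurable]: "D \<in> sets borel"
  proof -
    have "continuous_on UNIV (\<lambda>z::'a \<times> (rat \<Rightarrow> 'a). fst z + snd z q)" for q
      by (rule continuous_on_add[OF continuous_on_fst[OF continuous_on_id]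
          continuous_on_product_then_coordinatewise[OF continuous_on_snd[OF continuous_on_id]]])
    then have "{z \<in> space borel. hits_rat F V ((\<lambda>z q. fst z + snd z q) z)} \<in> sets (borel :: ('a \<times> (rat \<Rightarrow> 'a)) measure)"
      by (intro hits_rat_measurable borel_measurable_continuous_onI)
    moreover have "fst -` C \<inter> space borel \<in> sets (borel :: ('a \<times> (rat \<Rightarrow> 'a)) measure)"
      by (intro measurable_sets[OF borel_measurable_continuous_onI C] continuous_on_fst continuous_on_id)
    ultimately have "(fst -` C \<inter> space borel) - {z \<in> space borel. hits_rat F V ((\<lambda>z q. fst z + snd z q) z)} \<in> sets borel"
      by (rule sets.Diff[rotated])
    also have "(fst -` C \<inter> space borel) - {z \<in> space borel. hits_rat F V ((\<lambda>z q. fst z + snd z q) z)} = D"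
      by (auto simp: D_def)
    finally show ?thesis .
  qed
  have post [measurable]: "(\<lambda>\<omega>. (x + B (?T \<omega>) \<omega>, \<lambda>q. B (?T \<omega> + \<bar>real_of_rat q\<bar>) \<omega> - B (?T \<omega>) \<omega>)) \<in> borel_measurable M"
    by (intro measurable_Pair_borel measurable_post[OF rt] borel_measurable_add measurable_random_time[OF rt]) auto
  have rvB [measurable]: "random_variable borel (B \<bar>real_of_rat q\<bar>)" for q
    by (intro random_variable_B) simp
  have indep [measurable]: "(\<lambda>(\<omega>, \<omega>'). (x + B (?T \<omega>) \<omega>, \<lambda>q. B \<bar>real_of_rat q\<bar> \<omega>')) \<in> borel_measurable (M \<Otimes>\<^sub>M M)"
    unfolding case_prod_beta exit_point_def[symmetric] by (intro measurable_Pair_borel) measurable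
  define R where "R = (\<lambda>(\<omega>, \<omega>'). (x + B (?T \<omega>) \<omega>, \<lambda>q. B \<bar>real_of_rat q\<bar> \<omega>')) -` D \<inter> space (M \<Otimes>\<^sub>M M)"
  have R [measurable]: "R \<in> sets (M \<Otimes>\<^sub>M M)" unfolding R_def by measurable
  \<comment> \<open>With the first path fixed, the section is the event that a fresh motion from the
    exit point misses \<open>F\<close>, so its probability is given by
    \<open>hit_prob\<close>.\<close>
  have R_section: "Pair \<omega> -` R = (if ?Y \<omega> \<in> C then {\<omega>' \<in> space M. \<not> hits F V (\<lambda>t. ?Y \<omega> + B t \<omega>')} else {})"
    if "\<omega> \<in> space M" for \<omega>
    using that hits_iff_hits_rat[OF _ F V]
    by (auto simp: R_def D_def space_pair_measure exit_point_def)
  have "emeasure M {\<omega> \<in> space M. ?Y \<omega> \<in> C \<and> \<not> hits F V (\<lambda>t. x + B t \<omega>)} \<le>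
      emeasure M ((\<lambda>\<omega>. (x + B (?T \<omega>) \<omega>, \<lambda>q. B (?T \<omega> + \<bar>real_of_rat q\<bar>) \<omega> - B (?T \<omega>) \<omega>)) -` D \<inter> space M)"
  proof (rule emeasure_mono_AE)
    show "AE \<omega> in M. \<omega> \<in> {\<omega> \<in> space M. ?Y \<omega> \<in> C \<and> \<not> hits F V (\<lambda>t. x + B t \<omega>)} \<longrightarrow>
        \<omega> \<in> (\<lambda>\<omega>. (x + B (?T \<omega>) \<omega>, \<lambda>q. B (?T \<omega> + \<bar>real_of_rat q\<bar>) \<omega> - B (?T \<omega>) \<omega>)) -` D \<inter> space M"
      using AE AE_space
    proof eventually_elim
      case (elim \<omega>)
      note pr = exit_point_props(2,3)[OF W(1) elim(2,1)]
      have cont: "continuous_on {0..} (\<lambda>t. x + B (?T \<omega> + t) \<omega>)"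
        using pr(1) by (intro continuous_on_compose2[OF continuous_path[OF elim(2)]] continuous_intros) auto
      have "hits F V (\<lambda>t. x + B t \<omega>)" if "hits_rat F V (\<lambda>q. x + B (?T \<omega> + \<bar>real_of_rat q\<bar>) \<omega>)"
      proof -
        have "hits F V (\<lambda>t. x + B (?T \<omega> + t) \<omega>)"
          using hits_rat_iff[OF cont F V] that by simp
        then show ?thesis by (rule hits_shift) (use pr W(3) in auto)
      qed
      with elim(2) show ?case by (auto simp: D_def exit_point_def)
    qed
  qed measurable
  also have "\<dots> = emeasure (distr M borel (\<lambda>\<omega>. (x + B (?T \<omega>) \<omega>, \<lambda>q. B (?T \<omega> + \<bar>real_of_rat q\<bar>) \<omega> - B (?T \<omega>) \<omega>))) D"
    by (rule emeasure_distr[symmetric]) measurable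
  also have "\<dots> = emeasure (distr (M \<Otimes>\<^sub>M M) borel (\<lambda>(\<omega>, \<omega>'). (x + B (?T \<omega>) \<omega>, \<lambda>q. B \<bar>real_of_rat q\<bar> \<omega>'))) D"
    using strong_markov_exit(2)[OF W(1) AE] by (simp add: strong_markov_def)
  also have "\<dots> = emeasure (M \<Otimes>\<^sub>M M) R"
    unfolding R_def by (rule emeasure_distr) measurable
  also have "\<dots> = (\<integral>\<^sup>+\<omega>. emeasure M (Pair \<omega> -` R) \<partial>M)"
    by (rule emeasure_pair_measure_alt) measurable
  also have "\<dots> \<le> (\<integral>\<^sup>+\<omega>. ennreal c * indicator {\<omega> \<in> space M. ?Y \<omega> \<in> C} \<omega> \<partial>M)"
  proof (rule nn_integral_mono)
    fix \<omega> assume \<omega>: "\<omega> \<in> space M"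
    then show "emeasure M (Pair \<omega> -` R) \<le> ennreal c * indicator {\<omega> \<in> space M. ?Y \<omega> \<in> C} \<omega>"
      unfolding R_section[OF \<omega>] using le[of "?Y \<omega>"] c
      by (auto simp: emeasure_eq_measure prob_not_hits[OF F V] intro!: ennreal_leI)
  qed
  also have "\<dots> = ennreal c * emeasure M {\<omega> \<in> space M. ?Y \<omega> \<in> C}"
    by (rule nn_integral_cmult_indicator) measurable
  finally show ?thesis
    using c by (simp add: emeasure_eq_measure ennreal_mult[symmetric])
qed

section \<open>Iteration along the exhaustion\<close>

text \<open>Downward induction on \<open>n\<close> from \<open>m\<close>, each step contributing the
  factor \<open>1 - \<gamma> n\<close>. The bound is first shown on the frontier of
  \<open>V n\<close> and then carried inside by running the motion until it leaves
  \<open>V n\<close>.\<close>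

lemma exhaustion_bound:
  fixes V :: "nat \<Rightarrow> 'a set" and \<gamma> :: "nat \<Rightarrow> real"
  assumes F: "closed F" and \<gamma>: "\<And>n. \<gamma> n < 1"
    and V: "\<And>n. open (V n)" "\<And>n. bounded (V n)" "\<And>n. closure (V n) \<subseteq> V (Suc n)"
    and hyp: "\<And>n z. z \<in> frontier (V n) - F \<Longrightarrow>
      \<exists>E. closed E \<and> E \<subseteq> F \<inter> V (Suc n) \<and> \<gamma> n \<le> hit_prob E (V (Suc n)) z"
    and "n \<le> m" "x \<in> closure (V n)"
  shows "1 - hit_prob F (V m) x \<le> (\<Prod>j=n..<m. 1 - \<gamma> j)"
  using assms(7,8)
proof (induction n arbitrary: x rule: inc_induct)
  case base
  then show ?case by (simp add: hit_prob_def)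
next
  case (step n)
  let ?c = "\<Prod>j=Suc n..<m. 1 - \<gamma> j" and ?no = "{\<omega> \<in> space M. \<not> hits F (V m) (\<lambda>t. x + B t \<omega>)}"
  have prod_eq: "(\<Prod>j=n..<m. 1 - \<gamma> j) = (1 - \<gamma> n) * ?c"
    using step.hyps by (simp add: prod.atLeast_Suc_lessThan)
  have c: "0 \<le> ?c" "0 \<le> (1 - \<gamma> n) * ?c"
    using \<gamma> by (auto intro!: prod_nonneg mult_nonneg_nonneg simp: less_imp_le)
  have mono: "V i \<subseteq> V j" if "i \<le> j" for i j
    by (rule lift_Suc_mono_le[of V, OF subset_trans[OF closure_subset V(3)] that])
  have frontier: "1 - hit_prob F (V m) z \<le> (1 - \<gamma> n) * ?c" if z: "z \<in> frontier (V n)" for z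
  proof (cases "z \<in> F")
    case True
    have "z \<in> V (Suc n)" using z V(3)[of n] by (auto simp: frontier_def)
    then have "z \<in> V m" using mono[of "Suc n" m] step.hyps by auto
    with True show ?thesis using hit_prob_self[OF F V(1)] c by simp
  next
    case False
    with z hyp obtain E where E: "closed E" "E \<subseteq> F \<inter> V (Suc n)" "\<gamma> n \<le> hit_prob E (V (Suc n)) z" by blast
    \<comment> \<open>A path that avoids \<open>F\<close> leaves \<open>?W\<close> at a point of
      \<open>?C\<close>. There the induction hypothesis gives the factor \<open>?c\<close>, while
      reaching \<open>?C\<close> means missing \<open>E\<close>, which has probability at most
      \<open>1 - \<gamma> n\<close>.\<close>
    let ?W = "V (Suc n) - E" and ?C = "closure (V (Suc n)) - E"
    have W: "open ?W" "bounded ?W" "?W \<subseteq> V m"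
      using V(1,2)[of "Suc n"] E(1) mono[of "Suc n" m] step.hyps by (auto intro: bounded_diff)
    have zW: "z \<in> ?W" using z V(3)[of n] False E(2) by (auto simp: frontier_def)
    note [measurable] = exit_point_measurable[OF W(1)] hits_event[OF F V(1)] hits_event[OF E(1) V(1)]
    have C [measurable]: "?C \<in> sets borel" using E(1) by auto
    have "prob {\<omega> \<in> space M. \<not> hits F (V m) (\<lambda>t. z + B t \<omega>)} \<le>
        prob {\<omega> \<in> space M. exit_point ?W z \<omega> \<in> ?C \<and> \<not> hits F (V m) (\<lambda>t. z + B t \<omega>)}"
    proof (rule finite_measure_mono_AE)
      show "AE \<omega> in M. \<omega> \<in> {\<omega> \<in> space M. \<not> hits F (V m) (\<lambda>t. z + B t \<omega>)} \<longrightarrow>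
        \<omega> \<in> {\<omega> \<in> space M. exit_point ?W z \<omega> \<in> ?C \<and> \<not> hits F (V m) (\<lambda>t. z + B t \<omega>)}"
        using AE_exits_bounded[OF W(1,2), of z] AE_space
      proof eventually_elim
        case (elim \<omega>)
        have cl: "exit_point ?W z \<omega> \<in> closure (V (Suc n))"
          using exit_point_props(4)[OF W(1) elim(2,1) zW] closure_mono[of ?W "V (Suc n)"] by blast
        have "hits F (V m) (\<lambda>t. z + B t \<omega>)" if "hits E (V (Suc n)) (\<lambda>t. z + B t \<omega>)"
          using that E(2) mono[of "Suc n" m] step.hyps unfolding hits_def by (meson Suc_leI le_inf_iff subsetD)
        moreover have "hits E (V (Suc n)) (\<lambda>t. z + B t \<omega>)" if "exit_point ?W z \<omega> \<in> E"
          using exit_in_iff_hits[OF V(1) E(1) zW elim(2)] elim(1) that E(2) by blast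
        ultimately show ?case using cl elim by auto
      qed
    qed measurable
    also have "\<dots> \<le> ?c * prob {\<omega> \<in> space M. exit_point ?W z \<omega> \<in> ?C}"
      by (rule exit_bound[OF W F V(1) C c(1)]) (use step.IH in auto)
    also have "\<dots> \<le> ?c * (1 - \<gamma> n)"
    proof (rule mult_left_mono[OF _ c(1)])
      have "prob {\<omega> \<in> space M. exit_point ?W z \<omega> \<in> ?C} \<le>
          prob {\<omega> \<in> space M. \<not> hits E (V (Suc n)) (\<lambda>t. z + B t \<omega>)}"
        using exit_in_iff_hits[OF V(1) E(1) zW] by (intro finite_measure_mono) auto
      also have "\<dots> = 1 - hit_prob E (V (Suc n)) z" by (rule prob_not_hits[OF E(1) V(1)])
      finally show "prob {\<omega> \<in> space M. exit_point ?W z \<omega> \<in> ?C} \<le> 1 - \<gamma> n" using E(3) by linarith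
    qed
    finally show ?thesis by (simp add: prob_not_hits[OF F V(1)] mult.commute)
  qed
  show ?case
  proof (cases "x \<in> V n")
    case False
    with step.prems show ?thesis
      using frontier V(1)[of n] by (simp add: prod_eq frontier_def interior_open)
  next
    case True
    \<comment> \<open>From inside \<open>V n\<close> the motion almost surely leaves through the
      frontier, where the bound is already known.\<close>
    let ?C = "frontier (V n)"
    note [measurable] = exit_point_measurable[OF V(1)] hits_event[OF F V(1)]
    have C [measurable]: "?C \<in> sets borel" by simp
    have "prob ?no \<le> prob {\<omega> \<in> space M. exit_point (V n) x \<omega> \<in> ?C \<and> \<not> hits F (V m) (\<lambda>t. x + B t \<omega>)}"
    proof (rule finite_measure_mono_AE)
      show "AE \<omega> in M. \<omega> \<in> ?no \<longrightarrow>
        \<omega> \<in> {\<omega> \<in> space M. exit_point (V n) x \<omega> \<in> ?C \<and> \<not> hits F (V m) (\<lambda>t. x + B t \<omega>)}"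
        using AE_exits_bounded[OF V(1,2)[of n], of x] AE_space
      proof eventually_elim
        case (elim \<omega>)
        then show ?case
          using exit_point_props(1,4)[OF V(1) elim(2,1)] True V(1)[of n]
          by (simp add: frontier_def interior_open)
      qed
    qed measurable
    also have "\<dots> \<le> ((1 - \<gamma> n) * ?c) * prob {\<omega> \<in> space M. exit_point (V n) x \<omega> \<in> ?C}"
      using mono[of n m] step.hyps by (intro exit_bound V F C c(2) frontier) auto
    also have "\<dots> \<le> (1 - \<gamma> n) * ?c"
      using c(2) by (intro mult_right_le_one_le) auto
    finally show ?thesis by (simp add: prob_not_hits[OF F V(1)] prod_eq)
  qed
qed

end

section \<open>Divergent series and the conclusion\<close>

text \<open>Since \<open>1 - \<gamma> j \<le> exp (- \<gamma> j)\<close>, a lower bound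
  \<open>\<delta>\<close> on the products bounds the sums from \<open>n\<close> on by
  \<open>- ln \<delta>\<close>.\<close>

lemma summable_of_prod_bounded_below:
  fixes \<gamma> :: "nat \<Rightarrow> real"
  assumes \<gamma>: "\<And>n. 0 \<le> \<gamma> n" "\<And>n. \<gamma> n < 1" and \<delta>: "0 < \<delta>"
    and le: "\<And>m. n < m \<Longrightarrow> \<delta> \<le> (\<Prod>j=n..<m. 1 - \<gamma> j)"
  shows "summable \<gamma>"
proof (rule summableI_nonneg_bounded[OF \<gamma>(1)])
  fix k
  \<comment> \<open>Past \<open>k\<close> to dominate the partial sum, and strictly past
    \<open>n\<close> because the lower bound is assumed only there.\<close>
  define m where "m = max k (Suc n)"
  have m: "n < m" "k \<le> m" by (auto simp: m_def)
  have "\<delta> \<le> (\<Prod>j=n..<m. 1 - \<gamma> j)" by (rule le[OF m(1)])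
  also have "\<dots> \<le> (\<Prod>j=n..<m. exp (- \<gamma> j))"
    using \<gamma> exp_ge_add_one_self[of "- \<gamma> j" for j] by (intro prod_mono) (auto simp: less_imp_le)
  also have "\<dots> = exp (- (\<Sum>j=n..<m. \<gamma> j))"
    by (simp add: exp_sum sum_negf[symmetric])
  finally have "(\<Sum>j=n..<m. \<gamma> j) \<le> - ln \<delta>"
    using \<delta> ln_le_cancel_iff[of \<delta> "exp (- (\<Sum>j=n..<m. \<gamma> j))"] by simp
  moreover have "sum \<gamma> {..<k} \<le> sum \<gamma> {..<m}"
    using m \<gamma>(1) by (intro sum_mono2) auto
  moreover have "sum \<gamma> {..<m} = sum \<gamma> {..<n} + (\<Sum>j=n..<m. \<gamma> j)"
    using m(1) sum.atLeastLessThan_concat[of 0 n m \<gamma>] by (simp add: lessThan_atLeast0)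
  ultimately show "sum \<gamma> {..<k} \<le> sum \<gamma> {..<n} - ln \<delta>" by linarith
qed

theorem proposition2p1:
  fixes M :: "'w measure"
    and B :: "real \<Rightarrow> 'w \<Rightarrow> 'a::euclidean_space"
    and U A :: "'a set"
    and V :: "nat \<Rightarrow> 'a set"
    and \<gamma> :: "nat \<Rightarrow> real"
  assumes "brownian_motion M B"
    and "DIM('a) \<ge> 2"
    and "U \<noteq> {}" and "open U" and "connected U"
    and "closedin (top_of_set U) A"
    and "\<And>n. 0 \<le> \<gamma> n" and "\<And>n. \<gamma> n < 1"
    and "\<And>n. open (V n)" and "\<And>n. bounded (V n)" and "\<And>n. V n \<subseteq> U"
    and "\<And>n. closure (V n) \<subseteq> V (Suc n)"
    and "(\<Union>n. V n) = U"
    and "\<And>n z. z \<in> frontier (V n) - A \<Longrightarrow>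
           \<exists>E. closed E \<and> E \<subseteq> A \<inter> V (Suc n) \<and>
               dirichlet_solution M B (V (Suc n) - E) (indicator E) z \<ge> \<gamma> n"
  shows "(\<forall>n m. n < m \<longrightarrow>
            (\<forall>x\<in>closure (V n).
               dirichlet_solution M B (U - A) (indicator A) x \<ge> 1 - (\<Prod>j=n..<m. 1 - \<gamma> j))) \<and>
         (\<not> summable \<gamma> \<longrightarrow> unavoidable M B U A)"
proof -
  interpret brownian_motion M B by fact
  note U = \<open>open U\<close> and \<gamma> = assms(7,8) and V = assms(9,10,12)
  \<comment> \<open>\<open>A\<close> is closed only relative to \<open>U\<close>, whereas the path
    lemmas work with a set closed in the whole space.\<close>
  obtain F where F: "closed F" and A: "A = U \<inter> F" using assms(6) by (auto simp: closedin_closed)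
  have in_U: "x \<in> U" if "x \<in> closure (V n)" for x n using that V(3) assms(11) by blast
  have bound: "1 - (\<Prod>j=n..<m. 1 - \<gamma> j) \<le> hit_prob F U x" if "n < m" "x \<in> closure (V n)" for n m x
  proof -
    have "1 - hit_prob F (V m) x \<le> (\<Prod>j=n..<m. 1 - \<gamma> j)"
    proof (rule exhaustion_bound[where \<gamma> = \<gamma> and V = V, OF F \<gamma>(2) V])
      fix i z assume z: "z \<in> frontier (V i) - F"
      then have "z \<in> frontier (V i) - A" by (auto simp: A)
      then obtain E where E: "closed E" "E \<subseteq> A \<inter> V (Suc i)"
        "dirichlet_solution M B (V (Suc i) - E) (indicator E) z \<ge> \<gamma> i" using assms(14) by blast
      have "z \<in> V (Suc i)" using z V(3) by (auto simp: frontier_def)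
      moreover have "V (Suc i) \<inter> E = E" using E(2) by blast
      ultimately have "\<gamma> i \<le> hit_prob E (V (Suc i)) z"
        using dirichlet_solution_eq_hit_prob[OF V(1) E(1)] E(3) by metis
      with E show "\<exists>E. closed E \<and> E \<subseteq> F \<inter> V (Suc i) \<and> \<gamma> i \<le> hit_prob E (V (Suc i)) z" by (auto simp: A)
    qed (use that in auto)
    moreover have "hit_prob F (V m) x \<le> hit_prob F U x" by (rule hit_prob_mono[OF F V(1) U assms(11)])
    ultimately show ?thesis by linarith
  qed
  have "dirichlet_solution M B (U - A) (indicator A) x = hit_prob F U x" if "x \<in> U" for x
    unfolding A by (rule dirichlet_solution_eq_hit_prob[OF U F that])
  moreover have "unavoidable M B U A" if "\<not> summable \<gamma>"
    unfolding unavoidable_def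
  proof (intro conjI ballI)
    fix y assume y: "y \<in> U - A"
    then obtain n where "y \<in> V n" using assms(13) by blast
    then have n: "y \<in> closure (V n)" using closure_subset by blast
    have "hit_prob F U y \<le> 1" by (simp add: hit_prob_def)
    moreover have "\<not> hit_prob F U y < 1"
    proof
      \<comment> \<open>The positive number \<open>1 - hit_prob F U y\<close> would then bound all
        products from below, contradicting divergence.\<close>
      assume "hit_prob F U y < 1"
      then have "summable \<gamma>"
        using bound[OF _ n] by (intro summable_of_prod_bounded_below[OF \<gamma>, of "1 - hit_prob F U y" n]) force+
      with that show False ..
    qed
    ultimately have "hit_prob F U y = 1" by simp
    moreover have "U - A = U - F" "y \<in> U - F" using y by (auto simp: A)
    ultimately show "emeasure (harmonic_measure M B (U - A) y) A = 1"
      using harmonic_measure_eq_hit_prob[OF U F] by (simp add: A)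
  qed (fact assms(6))
  ultimately show ?thesis using bound in_U by auto
qed

end
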